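(* Let $A$ and $B$ be $C^*$-algebras and let $\phi\colon A\to B$ be a faithful surjective orthogonality preserving completely positive map. If $B$ is either simple, or prime, or has finite-dimensional centroid $Z(\mathcal M(B))$, then $\phi$ maps the Pedersen ideal of $A$ into the Pedersen ideal of $B$.
   Context: The Pedersen ideal of a $C^*$-algebra is its minimal dense two-sided ideal. A completely positive map $\phi:A\to B$ is orthogonality preserving (also called order zero) if $\phi(a)\phi(b)=0$ whenever $a,b\in A_+$ and $ab=0$. It is faithful if $a\in A_+$ and $\phi(a)=0$ imply $a=0$. $\mathcal M(B)$ is the multiplier algebra of $B$ and $Z(\mathcal M(B))$ its centre. *)

theory Defs
  imports "HOL-Analysis.Analysis"
begin

section \<open>Complex algebras and $C^*$-algebras\<close>

class scaleC = scaleR +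
  fixes scaleC :: "complex \<Rightarrow> 'a \<Rightarrow> 'a"  (infixr \<open>*\<^sub>C\<close> 75)

class complex_vector = scaleC + real_vector +
  assumes scaleC_add_right: "c *\<^sub>C (x + y) = c *\<^sub>C x + c *\<^sub>C y"
    and scaleC_add_left: "(c + d) *\<^sub>C x = c *\<^sub>C x + d *\<^sub>C x"
    and scaleC_scaleC: "c *\<^sub>C d *\<^sub>C x = (c * d) *\<^sub>C x"
    and scaleR_scaleC: "r *\<^sub>R x = complex_of_real r *\<^sub>C x"

lemma (in complex_vector) scaleC_one: "1 *\<^sub>C x = x"
  using scaleR_scaleC[of 1 x] by (simp add: scaleR_one)

global_interpretation complex_vector:
  vector_space "scaleC :: complex \<Rightarrow> 'a \<Rightarrow> 'a::complex_vector"
  by standard (simp_all add: scaleC_add_right scaleC_add_left scaleC_scaleC scaleC_one)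

class complex_algebra = complex_vector + real_algebra +
  assumes mult_scaleC_left: "(c *\<^sub>C x) * y = c *\<^sub>C (x * y)"
    and mult_scaleC_right: "x * (c *\<^sub>C y) = c *\<^sub>C (x * y)"

class star =
  fixes star :: "'a \<Rightarrow> 'a"

text \<open>No unit is assumed, and the zero algebra is allowed.\<close>

class cstar_algebra = complex_algebra + real_normed_algebra + banach + star +
  assumes norm_scaleC: "norm (c *\<^sub>C x) = cmod c * norm x"
    and star_star: "star (star x) = x"
    and star_add: "star (x + y) = star x + star y"
    and star_scaleC: "star (c *\<^sub>C x) = cnj c *\<^sub>C star x"
    and star_mult: "star (x * y) = star y * star x"
    and cstar_identity: "norm (star x * x) = (norm x)\<^sup>2"

definition clinear :: "('a::complex_vector \<Rightarrow> 'b::complex_vector) \<Rightarrow> bool" where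
  "clinear f \<longleftrightarrow> Vector_Spaces.linear scaleC scaleC f"

lemma clinear_iff:
  "clinear f \<longleftrightarrow> (\<forall>x y. f (x + y) = f x + f y) \<and> (\<forall>c x. f (c *\<^sub>C x) = c *\<^sub>C f x)"
  by (simp add: clinear_def Vector_Spaces.linear_iff complex_vector.vector_space_axioms)


section \<open>Ideals\<close>

definition two_sided_ideal :: "'a::complex_algebra set \<Rightarrow> bool" where
  "two_sided_ideal I \<longleftrightarrow> complex_vector.subspace I \<and>
     (\<forall>x\<in>I. \<forall>a. a * x \<in> I \<and> x * a \<in> I)"

definition dense_two_sided_ideal :: "'a::cstar_algebra set \<Rightarrow> bool" where
  "dense_two_sided_ideal I \<longleftrightarrow> two_sided_ideal I \<and> closure I = UNIV"

text \<open>The order on sets is inclusion, so \<open>LEAST\<close> denotes the dense two-sided ideal that is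
  contained in every dense two-sided ideal. That it exists is a theorem of Pedersen.\<close>

definition pedersen_ideal :: "'a::cstar_algebra set" where
  "pedersen_ideal = (LEAST K. dense_two_sided_ideal K)"

text \<open>As usual for $C^*$-algebras, simplicity and primeness refer to closed ideals.\<close>

definition simple_cstar :: "'a::cstar_algebra itself \<Rightarrow> bool" where
  "simple_cstar _ \<longleftrightarrow>
     (\<forall>I::'a set. two_sided_ideal I \<and> closed I \<longrightarrow> I = {0} \<or> I = UNIV)"

definition prime_cstar :: "'a::cstar_algebra itself \<Rightarrow> bool" where
  "prime_cstar _ \<longleftrightarrow>
     (\<forall>I J::'a set. two_sided_ideal I \<and> closed I \<and> two_sided_ideal J \<and> closed J \<and>
        (\<forall>x\<in>I. \<forall>y\<in>J. x * y = 0) \<longrightarrow> I = {0} \<or> J = {0})"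


section \<open>Completely positive and orthogonality preserving maps\<close>

definition positive :: "'a::cstar_algebra \<Rightarrow> bool" where
  "positive a \<longleftrightarrow> (\<exists>x. a = star x * x)"

text \<open>Elements of $M_n(A)$ are functions of two indices, of which only the values at indices
  below \<open>n\<close> matter. Positivity is \<open>M = X\<^sup>* X\<close> in $M_n(A)$, where
  \<open>(X\<^sup>*)\<^sub>i\<^sub>k = star (X\<^sub>k\<^sub>i)\<close>.\<close>

definition positive_matrix :: "nat \<Rightarrow> (nat \<Rightarrow> nat \<Rightarrow> 'a::cstar_algebra) \<Rightarrow> bool" where
  "positive_matrix n M \<longleftrightarrow>
     (\<exists>X. \<forall>i<n. \<forall>j<n. M i j = (\<Sum>k<n. star (X k i) * X k j))"

definition completely_positive :: "('a::cstar_algebra \<Rightarrow> 'b::cstar_algebra) \<Rightarrow> bool" where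
  "completely_positive \<phi> \<longleftrightarrow> clinear \<phi> \<and>
     (\<forall>n M. positive_matrix n M \<longrightarrow> positive_matrix n (\<lambda>i j. \<phi> (M i j)))"

definition orthogonality_preserving :: "('a::cstar_algebra \<Rightarrow> 'b::cstar_algebra) \<Rightarrow> bool" where
  "orthogonality_preserving \<phi> \<longleftrightarrow>
     (\<forall>a b. positive a \<and> positive b \<and> a * b = 0 \<longrightarrow> \<phi> a * \<phi> b = 0)"

definition faithful :: "('a::cstar_algebra \<Rightarrow> 'b::cstar_algebra) \<Rightarrow> bool" where
  "faithful \<phi> \<longleftrightarrow> (\<forall>a. positive a \<and> \<phi> a = 0 \<longrightarrow> a = 0)"


section \<open>The multiplier algebra\<close>

text \<open>Multipliers are double centralisers \<open>(L, R)\<close>: a multiplier \<open>m\<close> acts by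
  \<open>L x = m x\<close> and \<open>R x = x m\<close>.\<close>

definition double_centraliser ::
    "('a::cstar_algebra \<Rightarrow> 'a) \<Rightarrow> ('a \<Rightarrow> 'a) \<Rightarrow> bool" where
  "double_centraliser L R \<longleftrightarrow>
     clinear L \<and> bounded_linear L \<and> clinear R \<and> bounded_linear R \<and>
     (\<forall>x y. L (x * y) = L x * y) \<and> (\<forall>x y. R (x * y) = x * R y) \<and>
     (\<forall>x y. R x * y = x * L y)"

typedef (overloaded) 'a multiplier =
  "{(L, R). double_centraliser L (R :: 'a::cstar_algebra \<Rightarrow> 'a)}"
  morphisms rep_multiplier abs_multiplier
proof -
  have "double_centraliser (\<lambda>x::'a. x) (\<lambda>x. x)"
    by (simp add: double_centraliser_def clinear_iff bounded_linear_ident)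
  then show ?thesis by blast
qed

lemma bounded_linear_const_scaleC:
  fixes f :: "'a::real_normed_vector \<Rightarrow> 'b::cstar_algebra"
  assumes "bounded_linear f"
  shows "bounded_linear (\<lambda>x. c *\<^sub>C f x)"
proof (rule bounded_linear_compose[OF _ assms])
  show "bounded_linear (\<lambda>x::'b. c *\<^sub>C x)"
    by (rule bounded_linear_intro[where K = "cmod c"])
      (simp_all add: scaleC_add_right scaleR_scaleC scaleC_scaleC norm_scaleC mult.commute)
qed

setup_lifting type_definition_multiplier

instantiation multiplier :: (cstar_algebra) complex_algebra
begin

lift_definition zero_multiplier :: "'a multiplier" is "(\<lambda>_. 0, \<lambda>_. 0)"
  by (simp add: double_centraliser_def clinear_iff bounded_linear_zero)

lift_definition plus_multiplier :: "'a multiplier \<Rightarrow> 'a multiplier \<Rightarrow> 'a multiplier"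
  is "\<lambda>(L, R) (L', R'). (\<lambda>x. L x + L' x, \<lambda>x. R x + R' x)"
  by (auto simp: double_centraliser_def clinear_iff bounded_linear_add
      scaleC_add_right distrib_left distrib_right)

lift_definition uminus_multiplier :: "'a multiplier \<Rightarrow> 'a multiplier"
  is "\<lambda>(L, R). (\<lambda>x. - L x, \<lambda>x. - R x)"
  by (auto simp: double_centraliser_def clinear_iff bounded_linear_minus)

lift_definition minus_multiplier :: "'a multiplier \<Rightarrow> 'a multiplier \<Rightarrow> 'a multiplier"
  is "\<lambda>(L, R) (L', R'). (\<lambda>x. L x - L' x, \<lambda>x. R x - R' x)"
  by (auto simp: double_centraliser_def clinear_iff bounded_linear_sub
      complex_vector.scale_right_diff_distrib left_diff_distrib right_diff_distrib)

lift_definition times_multiplier :: "'a multiplier \<Rightarrow> 'a multiplier \<Rightarrow> 'a multiplier"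
  is "\<lambda>(L, R) (L', R'). (\<lambda>x. L (L' x), \<lambda>x. R' (R x))"
  by (auto simp: double_centraliser_def clinear_iff bounded_linear_compose)

lift_definition scaleC_multiplier :: "complex \<Rightarrow> 'a multiplier \<Rightarrow> 'a multiplier"
  is "\<lambda>c (L, R). (\<lambda>x. c *\<^sub>C L x, \<lambda>x. c *\<^sub>C R x)"
  by (auto simp: double_centraliser_def clinear_iff bounded_linear_const_scaleC
      scaleC_add_right scaleC_scaleC mult_scaleC_left mult_scaleC_right mult.commute)

definition scaleR_multiplier :: "real \<Rightarrow> 'a multiplier \<Rightarrow> 'a multiplier" where
  "scaleR_multiplier r m = complex_of_real r *\<^sub>C m"

instance
proof
  fix a b c :: "'a multiplier" and r s :: real and z w :: complex
  show "a + b + c = a + (b + c)" by transfer (auto simp: add.assoc)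
  show "a + b = b + a" by transfer (auto simp: add.commute)
  show "0 + a = a" by transfer auto
  show "- a + a = 0" by transfer auto
  show "a - b = a + - b" by transfer auto
  have addr: "z *\<^sub>C (a + b) = z *\<^sub>C a + z *\<^sub>C b" for z
    by transfer (auto simp: scaleC_add_right)
  have addl: "(z + w) *\<^sub>C a = z *\<^sub>C a + w *\<^sub>C a" for z w
    by transfer (auto simp: scaleC_add_left)
  have sc: "z *\<^sub>C w *\<^sub>C a = (z * w) *\<^sub>C a" for z w
    by transfer (auto simp: scaleC_scaleC)
  show "z *\<^sub>C (a + b) = z *\<^sub>C a + z *\<^sub>C b" by (rule addr)
  show "(z + w) *\<^sub>C a = z *\<^sub>C a + w *\<^sub>C a" by (rule addl)
  show "z *\<^sub>C w *\<^sub>C a = (z * w) *\<^sub>C a" by (rule sc)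
  show "r *\<^sub>R a = complex_of_real r *\<^sub>C a" by (simp add: scaleR_multiplier_def)
  show "r *\<^sub>R (a + b) = r *\<^sub>R a + r *\<^sub>R b" by (simp add: scaleR_multiplier_def addr)
  show "(r + s) *\<^sub>R a = r *\<^sub>R a + s *\<^sub>R a" by (simp add: scaleR_multiplier_def addl)
  show "r *\<^sub>R s *\<^sub>R a = (r * s) *\<^sub>R a" by (simp add: scaleR_multiplier_def sc)
  have "1 *\<^sub>C a = a" by transfer (auto simp: scaleC_one)
  then show "1 *\<^sub>R a = a" by (simp add: scaleR_multiplier_def)
  show "a * b * c = a * (b * c)" by transfer auto
  show "(a + b) * c = a * c + b * c"
    by transfer (auto simp: double_centraliser_def clinear_iff)
  show "a * (b + c) = a * b + a * c"
    by transfer (auto simp: double_centraliser_def clinear_iff)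
  have ml: "(z *\<^sub>C a) * b = z *\<^sub>C (a * b)" for z
    by transfer (auto simp: double_centraliser_def clinear_iff)
  have mr: "a * (z *\<^sub>C b) = z *\<^sub>C (a * b)" for z
    by transfer (auto simp: double_centraliser_def clinear_iff)
  show "(z *\<^sub>C a) * b = z *\<^sub>C (a * b)" by (rule ml)
  show "a * (z *\<^sub>C b) = z *\<^sub>C (a * b)" by (rule mr)
  show "(r *\<^sub>R a) * b = r *\<^sub>R (a * b)" by (simp add: scaleR_multiplier_def ml)
  show "a * (r *\<^sub>R b) = r *\<^sub>R (a * b)" by (simp add: scaleR_multiplier_def mr)
qed

end

definition centre :: "'a::complex_algebra set" where
  "centre = {z. \<forall>m. z * m = m * z}"

definition finite_dimensional :: "'a::complex_vector set \<Rightarrow> bool" where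
  "finite_dimensional V \<longleftrightarrow> (\<exists>F. finite F \<and> F \<subseteq> V \<and> V \<subseteq> complex_vector.span F)"

end

theory Submission
  imports Defs "HOL-Computational_Algebra.Formal_Power_Series"
begin

text \<open>
  By the structure theory of orthogonality preserving completely positive maps, \<open>\<phi> a = h \<pi>(a)\<close> with
  a homomorphism \<open>\<pi>\<close> and a positive multiplier \<open>h\<close> commuting with its range. When \<open>\<phi>\<close> is surjective,
  \<open>h\<close> is a central multiplier of \<open>B\<close>, and it is invertible: every \<open>b\<close> in \<open>B\<close> is a
  combination of products \<open>\<phi> p * \<phi> q = h \<phi> (p q)\<close>, so that \<open>h\<close> maps \<open>B\<close> onto \<open>B\<close>, and being central
  and onto it is injective. Hence \<open>\<phi>\<close> is the
  surjective homomorphism \<open>\<pi>\<close> up to an invertible central multiplier, and such a map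
  respects ideals and elements possessing a local unit.

  The proof extracts exactly this without constructing \<open>h\<close> or \<open>\<pi>\<close>. The multiplicative content of the
  structure theorem is the identity \<open>\<phi> (x a) \<phi> y = \<phi> x \<phi> (a y)\<close> (\<open>order_zero_shift\<close>). From it and
  surjectivity one finds for every \<open>y\<close> an element \<open>d\<close> of \<open>B\<close>, morally \<open>\<pi> y\<close>, with
  \<open>\<phi> (f y) = \<phi> f d\<close> and \<open>\<phi> (y f) = d \<phi> f\<close> for all \<open>f\<close> (\<open>surjective_order_zero_modular\<close>). Therefore
  the preimage of a two-sided ideal is a two-sided ideal, and if \<open>f e = f\<close>, then \<open>\<phi> f\<close> has a right unit.

  On the side of the ideals, an element \<open>f\<close> with \<open>f e = f\<close> for some \<open>e\<close> lies in every dense two-sided ideal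
  (\<open>mem_dense_ideal_if_right_unit\<close>), and every two-sided ideal that contains all such \<open>f\<close> is dense
  (\<open>closure_ideal_UNIV\<close>). This proves that the Pedersen ideal exists, and shows that the
  preimage of the Pedersen ideal of \<open>B\<close> is a dense two-sided ideal of \<open>A\<close>, which hence contains
  the Pedersen ideal of \<open>A\<close>.

  The identity \<open>order_zero_shift\<close> is obtained as follows. Complete positivity upgrades orthogonality of
  positive elements to \<open>\<phi> (v x) \<phi> (y w) = 0\<close> whenever \<open>x y = 0\<close>
  (\<open>orthogonality_preserving_products\<close>). For self-adjoint \<open>a\<close> the bilinear map
  \<open>(f, g) \<mapsto> \<phi> (v x f(a)) \<phi> (g(a) y w)\<close> then vanishes on functions with \<open>f g = 0\<close>, and it is bounded because
  positive maps are. Such a bilinear map is concentrated on the diagonal, so that it takes the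
  same value at \<open>(id, 1)\<close> and \<open>(1, id)\<close> (\<open>diagonal\<close>).

  What remains is the basic theory of $C^*$-algebras: the unitization, the continuous functional
  calculus of a self-adjoint element and the order. The functional calculus rests on the estimate
  \<open>\<parallel>p(a)\<parallel> \<le> sup |p|\<close> on \<open>[- \<parallel>a\<parallel>, \<parallel>a\<parallel>]\<close> (\<open>norm_poly_at_le\<close>), which is proved by Fourier coefficients and the
  identity \<open>\<parallel>b\<^sup>2\<parallel> = \<parallel>b\<parallel>\<^sup>2\<close> for self-adjoint \<open>b\<close> rather than by spectral theory.
\<close>

section \<open>Elementary facts about the involution\<close>

lemma star_zero [simp]: "star (0::'a::cstar_algebra) = 0"
  using star_add[of "0::'a" 0] by simp

lemma star_minus: "star (- x::'a::cstar_algebra) = - star x"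
  using star_add[of x "- x"] by (simp add: eq_neg_iff_add_eq_0 add.commute)

lemma star_diff: "star (x - y::'a::cstar_algebra) = star x - star y"
  using star_add[of x "- y"] by (simp add: star_minus)

lemma star_scaleR: "star (r *\<^sub>R x::'a::cstar_algebra) = r *\<^sub>R star x"
  by (simp add: scaleR_scaleC star_scaleC)

lemma norm_star [simp]: "norm (star x) = norm (x::'a::cstar_algebra)"
proof -
  have le: "norm y \<le> norm (star y)" for y :: 'a
  proof (cases "y = 0")
    case False
    have "norm y * norm y \<le> norm (star y) * norm y"
      using cstar_identity[of y] norm_mult_ineq[of "star y" y] by (simp add: power2_eq_square)
    then show ?thesis using False by simp
  qed simp
  show ?thesis using le[of x] le[of "star x"] by (simp add: star_star)
qed

lemma cstar_identity': "norm (x * star x) = (norm (x::'a::cstar_algebra))\<^sup>2"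
  using cstar_identity[of "star x"] by (simp add: star_star)

lemma star_mult_self_eq_zero: "star x * x = 0 \<longleftrightarrow> (x::'a::cstar_algebra) = 0"
  using cstar_identity[of x] by auto

lemma mult_star_self_eq_zero: "x * star x = 0 \<longleftrightarrow> (x::'a::cstar_algebra) = 0"
  using cstar_identity'[of x] by auto

lemma bounded_linear_star: "bounded_linear (star :: 'a::cstar_algebra \<Rightarrow> 'a)"
  by (rule bounded_linear_intro[where K = 1]) (simp_all add: star_add star_scaleR)

lemmas tendsto_star [tendsto_intros] = bounded_linear.tendsto[OF bounded_linear_star]

text \<open>A $C^*$-algebra acts faithfully on itself, so identities may be tested after multiplication by
  arbitrary elements. This is how an identity that holds only after multiplying by values of a
  surjective map is turned into an identity.\<close>

lemma annihilator_zero: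
  assumes "\<And>y. x * y = 0" shows "(x::'a::cstar_algebra) = 0"
  using assms[of "star x"] by (simp add: mult_star_self_eq_zero)

lemma annihilator_zero':
  assumes "\<And>y. y * x = 0" shows "(x::'a::cstar_algebra) = 0"
  using assms[of "star x"] by (simp add: star_mult_self_eq_zero)

section \<open>Adjoining a unit\<close>

datatype 'a unitization = Unitization (apart: 'a) (cpart: complex)

text \<open>For a nonunital algebra the operator norm of left multiplication is the $C^*$-norm of the
  unitization. If the algebra has a unit already, this is only a seminorm, vanishing on
  \<open>1 - e\<close>; taking the maximum with the modulus of the scalar part, which is another
  $C^*$-seminorm, repairs this and covers both cases at once.\<close>

definition left_action :: "'a::cstar_algebra unitization \<Rightarrow> 'a \<Rightarrow> 'a" where
  "left_action z x = apart z * x + cpart z *\<^sub>C x"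

lemma bounded_linear_left_action: "bounded_linear (left_action z)"
  unfolding left_action_def
  by (intro bounded_linear_add bounded_linear_const_mult bounded_linear_const_scaleC bounded_linear_ident)

definition unorm :: "'a::cstar_algebra unitization \<Rightarrow> real" where
  "unorm z = max (onorm (left_action z)) (cmod (cpart z))"

lemma left_action_bound: "norm (left_action z x) \<le> unorm z * norm x"
  using onorm[OF bounded_linear_left_action[of z], of x]
    mult_right_mono[of "onorm (left_action z)" "unorm z" "norm x"]
  by (simp add: unorm_def)

lemma cpart_bound: "cmod (cpart z) \<le> unorm z"
  by (simp add: unorm_def)

lemma unorm_nonneg: "0 \<le> unorm z"
  using cpart_bound[of z] norm_ge_zero[of "cpart z"] by linarith

lemma unorm_le:
  assumes "\<And>x. norm (left_action z x) \<le> c * norm x" and "cmod (cpart z) \<le> c"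
  shows "unorm z \<le> c"
  using onorm_bound[of c "left_action z"] assms norm_ge_zero[of "cpart z"]
  unfolding unorm_def by (metis max.boundedI order_trans)

text \<open>Testing \<open>left_action z\<close> at \<open>star (apart z)\<close> recovers the norm of \<open>apart z\<close>. With
  \<open>unorm_le_parts\<close> this makes the norm equivalent to the sum of the norms of the two parts, which
  gives completeness.\<close>

lemma apart_bound: "norm (apart z) \<le> 2 * unorm z"
proof (cases "apart z = 0")
  case True then show ?thesis by (simp add: unorm_nonneg)
next
  case False
  let ?a = "apart z"
  have "norm (?a * star ?a) \<le> norm (left_action z (star ?a)) + norm (cpart z *\<^sub>C star ?a)"
    using norm_triangle_ineq4[of "left_action z (star ?a)" "cpart z *\<^sub>C star ?a"]
    by (simp add: left_action_def)
  also have "\<dots> \<le> unorm z * norm ?a + unorm z * norm ?a"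
    using left_action_bound[of z "star ?a"] mult_right_mono[OF cpart_bound[of z], of "norm ?a"]
    by (simp add: norm_scaleC)
  finally have "norm ?a * norm ?a \<le> (2 * unorm z) * norm ?a"
    by (simp add: cstar_identity' power2_eq_square)
  then show ?thesis using False by simp
qed

lemma unorm_le_parts: "unorm z \<le> norm (apart z) + cmod (cpart z)"
proof (rule unorm_le)
  fix x
  show "norm (left_action z x) \<le> (norm (apart z) + cmod (cpart z)) * norm x"
    unfolding left_action_def distrib_right
    by (rule order_trans[OF norm_triangle_ineq]) (simp add: norm_scaleC norm_mult_ineq)
qed simp

instantiation unitization :: (cstar_algebra) "{complex_algebra, real_algebra_1, real_normed_vector, star}"
begin

definition "0 = Unitization 0 0"
definition "1 = Unitization 0 1"
definition "z + w = Unitization (apart z + apart w) (cpart z + cpart w)"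
definition "z - w = Unitization (apart z - apart w) (cpart z - cpart w)"
definition "- z = Unitization (- apart z) (- cpart z)"
definition "c *\<^sub>C z = Unitization (c *\<^sub>C apart z) (c * cpart z)"
definition "r *\<^sub>R z = Unitization (r *\<^sub>R apart z) (complex_of_real r * cpart z)"
definition "z * w = Unitization
  (apart z * apart w + cpart z *\<^sub>C apart w + cpart w *\<^sub>C apart z) (cpart z * cpart w)"
definition "star z = Unitization (star (apart z)) (cnj (cpart z))"
definition "norm (z::'a unitization) = unorm z"
definition "dist z w = norm (z - w :: 'a unitization)"
definition "sgn z = inverse (norm z) *\<^sub>R (z :: 'a unitization)"
definition "(uniformity :: ('a unitization \<times> 'a unitization) filter) =
  (INF e\<in>{0<..}. principal {(x, y). dist x y < e})"
definition "open (U :: 'a unitization set) \<longleftrightarrow>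
  (\<forall>x\<in>U. eventually (\<lambda>(x', y). x' = x \<longrightarrow> y \<in> U) uniformity)"

lemma apart_simps [simp]:
  "apart 0 = (0::'a)" "apart 1 = (0::'a)"
  "apart (z + w) = apart z + apart (w::'a unitization)" "apart (z - w) = apart z - apart (w::'a unitization)"
  "apart (- z) = - apart (z::'a unitization)" "apart (c *\<^sub>C z) = c *\<^sub>C apart (z::'a unitization)"
  "apart (r *\<^sub>R z) = r *\<^sub>R apart (z::'a unitization)"
  "apart (z * w) = apart z * apart w + cpart z *\<^sub>C apart w + cpart w *\<^sub>C apart (z::'a unitization)"
  "apart (star z) = star (apart (z::'a unitization))"
  by (simp_all add: zero_unitization_def one_unitization_def plus_unitization_def
    minus_unitization_def uminus_unitization_def scaleC_unitization_def scaleR_unitization_def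
    times_unitization_def star_unitization_def)

lemma cpart_simps [simp]:
  "cpart (0::'a unitization) = 0" "cpart (1::'a unitization) = 1"
  "cpart (z + w) = cpart z + cpart (w::'a unitization)" "cpart (z - w) = cpart z - cpart (w::'a unitization)"
  "cpart (- z) = - cpart (z::'a unitization)" "cpart (c *\<^sub>C z) = c * cpart (z::'a unitization)"
  "cpart (r *\<^sub>R z) = complex_of_real r * cpart (z::'a unitization)"
  "cpart (z * w) = cpart z * cpart (w::'a unitization)"
  "cpart (star z) = cnj (cpart (z::'a unitization))"
  by (simp_all add: zero_unitization_def one_unitization_def plus_unitization_def
    minus_unitization_def uminus_unitization_def scaleC_unitization_def scaleR_unitization_def
    times_unitization_def star_unitization_def)

lemma unitization_eqI: "apart z = apart w \<Longrightarrow> cpart z = cpart w \<Longrightarrow> z = (w::'a unitization)"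
  by (rule unitization.expand) simp

lemma left_action_simps:
  "left_action (z + w) x = left_action z x + left_action w (x::'a)"
  "left_action (c *\<^sub>C z) x = c *\<^sub>C left_action z (x::'a)"
  "left_action (z * w) x = left_action z (left_action w (x::'a))"
  by (simp_all add: left_action_def algebra_simps scaleC_add_left scaleC_add_right scaleC_scaleC
      mult_scaleC_left mult_scaleC_right)

lemma norm_unitization_zero: "(norm z = 0) = (z = (0::'a unitization))"
proof
  assume "norm z = 0"
  then have "cmod (cpart z) \<le> 0" "norm (apart z) \<le> 0"
    using cpart_bound[of z] apart_bound[of z] by (simp_all add: norm_unitization_def)
  then show "z = 0" by (intro unitization_eqI) simp_all
next
  assume "z = 0"
  then have "unorm z \<le> 0"
    using unorm_le_parts[of z] by simp
  then show "norm z = 0" using unorm_nonneg[of z] by (simp add: norm_unitization_def)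
qed

lemma norm_unitization_scaleC: "norm (c *\<^sub>C z) = cmod c * norm (z::'a unitization)"
proof -
  have le: "norm (c *\<^sub>C z) \<le> cmod c * norm z" for c and z :: "'a unitization"
    unfolding norm_unitization_def
    by (rule unorm_le)
      (simp_all add: left_action_simps norm_scaleC norm_mult mult_left_mono cpart_bound
        left_action_bound mult.assoc)
  show ?thesis
  proof (cases "c = 0")
    case True
    then have "c *\<^sub>C z = 0" by (intro unitization_eqI) simp_all
    then show ?thesis using True norm_unitization_zero[of 0] by simp
  next
    case False
    have "inverse c *\<^sub>C c *\<^sub>C z = z"
      using False by (intro unitization_eqI) (simp_all add: scaleC_scaleC scaleC_one)
    then have "norm z \<le> inverse (cmod c) * norm (c *\<^sub>C z)"
      using le[of "inverse c" "c *\<^sub>C z"] by (simp add: norm_inverse)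
    then have "cmod c * norm z \<le> norm (c *\<^sub>C z)"
      using False by (simp add: field_simps)
    then show ?thesis using le[of c z] by simp
  qed
qed

instance
proof
  fix a b c :: "'a unitization" and r s :: real and z w :: complex
  show addr: "z *\<^sub>C (a + b) = z *\<^sub>C a + z *\<^sub>C b"
    by (intro unitization_eqI) (simp_all add: scaleC_add_right algebra_simps)
  show addl: "(z + w) *\<^sub>C a = z *\<^sub>C a + w *\<^sub>C a"
    by (intro unitization_eqI) (simp_all add: scaleC_add_left algebra_simps)
  show "z *\<^sub>C w *\<^sub>C a = (z * w) *\<^sub>C a"
    by (intro unitization_eqI) (simp_all add: scaleC_scaleC)
  show sR: "r *\<^sub>R a = complex_of_real r *\<^sub>C a"
    by (intro unitization_eqI) (simp_all add: scaleR_scaleC)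
  show "norm (a + b) \<le> norm a + norm b"
    unfolding norm_unitization_def
  proof (rule unorm_le)
    fix x :: 'a
    show "norm (left_action (a + b) x) \<le> (unorm a + unorm b) * norm x"
      using left_action_bound[of a x] left_action_bound[of b x]
        norm_triangle_ineq[of "left_action a x" "left_action b x"]
      by (simp add: left_action_simps distrib_right)
    show "cmod (cpart (a + b)) \<le> unorm a + unorm b"
      using cpart_bound[of a] cpart_bound[of b] norm_triangle_ineq[of "cpart a" "cpart b"] by simp
  qed
  show "norm (r *\<^sub>R a) = \<bar>r\<bar> * norm a"
    by (simp add: sR norm_unitization_scaleC)
  show "(norm a = 0) = (a = 0)" by (rule norm_unitization_zero)
  show "(0::'a unitization) \<noteq> 1"
    by (simp add: zero_unitization_def one_unitization_def)
qed (auto intro!: unitization_eqI simp: algebra_simps scaleC_add_left scaleC_add_right scaleC_scaleC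
    mult_scaleC_left mult_scaleC_right scaleR_scaleC dist_unitization_def sgn_unitization_def
    uniformity_unitization_def open_unitization_def scaleC_one)

end

lemma norm_unitization: "norm (z::'a::cstar_algebra unitization) = unorm z"
  by (simp add: norm_unitization_def)

text \<open>The operator norm satisfies the $C^*$-identity because
  \<open>\<parallel>z x\<parallel>\<^sup>2 = \<parallel>x\<^sup>* z\<^sup>* z x\<parallel> \<le> \<parallel>z\<^sup>* z\<parallel> \<parallel>x\<parallel>\<^sup>2\<close>.\<close>

lemma unorm_star_mult: "(unorm z)\<^sup>2 \<le> unorm (star z * z)"
  for z :: "'a::cstar_algebra unitization"
proof -
  let ?s = "unorm (star z * z)"
  have "norm (left_action z x) \<le> sqrt ?s * norm x" for x
  proof -
    have "star (left_action z x) * left_action z x = star x * left_action (star z * z) x"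
      by (simp add: left_action_def star_add star_mult star_scaleC algebra_simps
          scaleC_add_left scaleC_add_right scaleC_scaleC mult_scaleC_left mult_scaleC_right)
    then have "(norm (left_action z x))\<^sup>2 \<le> norm x * (?s * norm x)"
      using norm_mult_ineq[of "star x" "left_action (star z * z) x"]
        mult_left_mono[OF left_action_bound[of "star z * z" x] norm_ge_zero[of x]]
      by (simp flip: cstar_identity)
    then have "(norm (left_action z x))\<^sup>2 \<le> (sqrt ?s * norm x)\<^sup>2"
      by (simp add: power_mult_distrib unorm_nonneg power2_eq_square algebra_simps)
    then show ?thesis by (rule power2_le_imp_le) (simp add: unorm_nonneg)
  qed
  moreover have "cmod (cpart z) \<le> sqrt ?s"
  proof -
    have "(cmod (cpart z))\<^sup>2 \<le> ?s"
      using cpart_bound[of "star z * z"] by (simp add: norm_mult power2_eq_square)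
    then show ?thesis by (rule real_le_rsqrt)
  qed
  ultimately have "unorm z \<le> sqrt ?s" by (rule unorm_le)
  then have "(unorm z)\<^sup>2 \<le> (sqrt ?s)\<^sup>2" by (rule power_mono) (rule unorm_nonneg)
  then show ?thesis by (simp add: unorm_nonneg)
qed

lemma unorm_mult: "unorm (z * w) \<le> unorm z * unorm (w :: 'a::cstar_algebra unitization)"
proof (rule unorm_le)
  fix x
  have "norm (left_action z (left_action w x)) \<le> unorm z * (unorm w * norm x)"
    using left_action_bound[of z "left_action w x"]
      mult_left_mono[OF left_action_bound[of w x] unorm_nonneg[of z]] by linarith
  then show "norm (left_action (z * w) x) \<le> unorm z * unorm w * norm x"
    by (simp add: left_action_simps mult.assoc)
qed (simp add: norm_mult mult_mono cpart_bound unorm_nonneg)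

lemma bounded_linear_apart: "bounded_linear (apart :: 'a::cstar_algebra unitization \<Rightarrow> 'a)"
  by (rule bounded_linear_intro[where K = 2])
    (simp_all add: norm_unitization apart_bound[unfolded mult.commute[of 2]])

lemma bounded_linear_cpart: "bounded_linear (cpart :: 'a::cstar_algebra unitization \<Rightarrow> complex)"
  by (rule bounded_linear_intro[where K = 1])
    (simp_all add: norm_unitization cpart_bound scaleR_conv_of_real[where 'a = complex])

instance unitization :: (cstar_algebra) "{cstar_algebra, real_normed_algebra_1}"
proof
  fix z w :: "'a unitization" and c :: complex
  show "norm (1::'a unitization) = 1"
  proof (rule antisym)
    show "norm (1::'a unitization) \<le> 1"
      unfolding norm_unitization by (rule unorm_le) (simp_all add: left_action_def scaleC_one)
    show "1 \<le> norm (1::'a unitization)"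
      using cpart_bound[of "1::'a unitization"] by (simp add: norm_unitization)
  qed
  show "norm (z * w) \<le> norm z * norm w"
    by (simp add: norm_unitization unorm_mult)
  show "norm (c *\<^sub>C z) = cmod c * norm z" by (rule norm_unitization_scaleC)
  show ss: "star (star z) = z" for z :: "'a unitization"
    by (intro unitization_eqI) (simp_all add: star_star)
  show "star (z + w) = star z + star w"
    by (intro unitization_eqI) (simp_all add: star_add)
  show "star (c *\<^sub>C z) = cnj c *\<^sub>C star z"
    by (intro unitization_eqI) (simp_all add: star_scaleC)
  show "star (z * w) = star w * star z"
    by (intro unitization_eqI) (simp_all add: star_mult star_add star_scaleC algebra_simps)
  have le: "unorm z \<le> unorm (star z)" for z :: "'a unitization"
  proof (cases "unorm z = 0")
    case True then show ?thesis by (simp add: unorm_nonneg)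
  next
    case False
    have "unorm z * unorm z \<le> unorm (star z) * unorm z"
      using unorm_star_mult[of z] unorm_mult[of "star z" z] by (simp add: power2_eq_square)
    then show ?thesis using False unorm_nonneg[of z] by simp
  qed
  have "unorm (star z) = unorm z" using le[of z] le[of "star z"] by (simp add: ss)
  then show "norm (star z * z) = (norm z)\<^sup>2"
    using unorm_star_mult[of z] unorm_mult[of "star z" z]
    by (simp add: norm_unitization power2_eq_square)
next
  fix X :: "nat \<Rightarrow> 'a unitization"
  assume X: "Cauchy X"
  have "Cauchy (\<lambda>n. apart (X n))"
    by (rule bounded_linear.Cauchy[OF bounded_linear_apart X])
  then obtain a where a: "(\<lambda>n. apart (X n)) \<longlonglongrightarrow> a"
    by (auto simp: Cauchy_convergent_iff convergent_def)
  have "Cauchy (\<lambda>n. cpart (X n))"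
    by (rule bounded_linear.Cauchy[OF bounded_linear_cpart X])
  then obtain c where c: "(\<lambda>n. cpart (X n)) \<longlonglongrightarrow> c"
    by (auto simp: Cauchy_convergent_iff convergent_def)
  have "(\<lambda>n. norm (apart (X n) - a) + cmod (cpart (X n) - c)) \<longlonglongrightarrow> norm (a - a) + cmod (c - c)"
    by (intro tendsto_intros a c)
  then have lim0: "(\<lambda>n. norm (apart (X n) - a) + cmod (cpart (X n) - c)) \<longlonglongrightarrow> 0"
    by simp
  have "norm (X n - Unitization a c) \<le> norm (apart (X n) - a) + cmod (cpart (X n) - c)" for n
    using unorm_le_parts[of "X n - Unitization a c"] by (simp add: norm_unitization)
  then have "(\<lambda>n. X n - Unitization a c) \<longlonglongrightarrow> 0"
    by (intro Lim_null_comparison[OF _ lim0] always_eventually allI)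
  then have "X \<longlonglongrightarrow> Unitization a c" by (simp add: LIM_zero_iff)
  then show "convergent X" by (auto simp: convergent_def)
qed

definition incl :: "'a::cstar_algebra \<Rightarrow> 'a unitization" where
  "incl a = Unitization a 0"

lemma apart_incl [simp]: "apart (incl a) = a" and cpart_incl [simp]: "cpart (incl a) = 0"
  by (simp_all add: incl_def)

lemma incl_simps:
  "incl (a + b) = incl a + incl b" "incl (a - b) = incl a - incl b" "incl (- a) = - incl a"
  "incl (a * b) = incl a * incl b" "incl 0 = 0" "incl (star a) = star (incl a)"
  "incl (c *\<^sub>C a) = c *\<^sub>C incl a" "incl (r *\<^sub>R a) = r *\<^sub>R incl a"
  by (intro unitization_eqI; simp)+

lemma incl_apart: "cpart z = 0 \<Longrightarrow> incl (apart z) = z"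
  by (intro unitization_eqI) simp_all

lemma incl_eq_iff [simp]: "incl a = incl b \<longleftrightarrow> a = b"
  by (metis apart_incl)

lemma norm_incl [simp]: "norm (incl a) = norm a"
proof (rule antisym)
  show "norm (incl a) \<le> norm a"
    using unorm_le_parts[of "incl a"] by (simp add: norm_unitization)
  show "norm a \<le> norm (incl a)"
  proof (cases "a = 0")
    case False
    have "norm a * norm a \<le> norm (incl a) * norm a"
      using left_action_bound[of "incl a" "star a"]
      by (simp add: left_action_def cstar_identity' norm_unitization power2_eq_square)
    then show ?thesis using False by simp
  qed simp
qed

section \<open>Polynomials of a self-adjoint element\<close>

lemma star_one [simp]: "star (1::'a::{cstar_algebra, real_normed_algebra_1}) = 1"
  by (metis mult.right_neutral star_mult star_star)

lemma star_of_real [simp]: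
  "star (of_real r :: 'a::{cstar_algebra, real_normed_algebra_1}) = of_real r"
  by (simp add: of_real_def star_scaleR)

lemma star_power: "star (a ^ n) = star (a::'a::{cstar_algebra, real_normed_algebra_1}) ^ n"
  by (induction n) (simp_all add: star_mult power_commutes)

definition poly_at :: "real poly \<Rightarrow> 'a::real_algebra_1 \<Rightarrow> 'a" where
  "poly_at p a = fold_coeffs (\<lambda>c b. of_real c + a * b) p 0"

lemma poly_at_0 [simp]: "poly_at 0 a = 0"
  by (simp add: poly_at_def)

lemma poly_at_pCons [simp]: "poly_at (pCons c p) a = of_real c + a * poly_at p a"
  by (cases "p = 0 \<and> c = 0") (auto simp: poly_at_def)

lemma poly_at_add: "poly_at (p + q) a = poly_at p a + poly_at q a"
  by (induction p q rule: poly_induct2) (simp_all add: algebra_simps)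

lemma poly_at_smult: "poly_at (smult c p) a = c *\<^sub>R poly_at p a"
  by (induction p) (simp_all add: algebra_simps of_real_def)

lemma poly_at_mult: "poly_at (p * q) a = poly_at p a * poly_at q a"
  by (induction p) (simp_all add: poly_at_add poly_at_smult algebra_simps scaleR_conv_of_real)

lemma poly_at_1 [simp]: "poly_at 1 a = 1"
  unfolding one_pCons by simp

lemma poly_at_power: "poly_at (p ^ n) a = poly_at p a ^ n"
  by (induction n) (simp_all add: poly_at_mult)

lemma of_real_commute: "of_real c * a = a * (of_real c :: 'a::real_algebra_1)"
  by (simp add: of_real_def)

text \<open>This is what later replaces the comparison of the spectra of \<open>y y\<^sup>*\<close> and \<open>y\<^sup>* y\<close>.\<close>

lemma poly_at_intertwine: "a * y = y * b \<Longrightarrow> poly_at p a * y = y * poly_at p b"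
proof (induction p)
  case (pCons c p)
  have "a * poly_at p a * y = y * b * poly_at p b"
    using pCons by (metis mult.assoc)
  then show ?case by (simp add: algebra_simps of_real_commute)
qed simp

lemma star_poly_at:
  "star (poly_at p a) = poly_at p (star a::'a::{cstar_algebra, real_normed_algebra_1})"
proof (induction p)
  case (pCons c p)
  then show ?case
    using poly_at_intertwine[of "star a" "star a" "star a" p]
    by (simp add: star_add star_mult)
qed simp

lemma poly_at_pcompose: "poly_at (pcompose p [:0, r:]) a = poly_at p (r *\<^sub>R a)"
  by (induction p)
    (simp_all add: pcompose_pCons poly_at_add poly_at_mult poly_at_smult)

lemma poly_at_zero: "poly_at p 0 = of_real (poly p 0)"
  by (induction p) simp_all

lemma tendsto_poly_at:
  fixes X :: "nat \<Rightarrow> 'a::real_normed_algebra_1"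
  assumes "X \<longlonglongrightarrow> a"
  shows "(\<lambda>n. poly_at p (X n)) \<longlonglongrightarrow> poly_at p a"
  by (induction p) (auto intro!: tendsto_intros assms)

definition cpoly_at :: "complex poly \<Rightarrow> 'a::{complex_algebra, real_algebra_1} \<Rightarrow> 'a" where
  "cpoly_at p a = fold_coeffs (\<lambda>c b. c *\<^sub>C 1 + a * b) p 0"

lemma cpoly_at_0 [simp]: "cpoly_at 0 a = 0"
  by (simp add: cpoly_at_def)

lemma cpoly_at_pCons [simp]: "cpoly_at (pCons c p) a = c *\<^sub>C 1 + a * cpoly_at p a"
  by (cases "p = 0 \<and> c = 0") (auto simp: cpoly_at_def)

lemma cpoly_at_add: "cpoly_at (p + q) a = cpoly_at p a + cpoly_at q a"
  by (induction p q rule: poly_induct2) (simp_all add: algebra_simps scaleC_add_left)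

lemma cpoly_at_smult: "cpoly_at (smult c p) a = c *\<^sub>C cpoly_at p a"
  by (induction p) (simp_all add: scaleC_add_right scaleC_scaleC mult_scaleC_right)

lemma cpoly_at_monom: "cpoly_at (monom c n) a = c *\<^sub>C a ^ n"
  by (induction n) (simp_all add: monom_0 monom_Suc mult_scaleC_right)

lemma norm_cpoly_at_le:
  fixes w :: "'a::{cstar_algebra, real_normed_algebra_1}"
  assumes "norm w \<le> 1" and "\<And>j. cmod (coeff q j) \<le> s"
  shows "norm (cpoly_at q w) \<le> (real (degree q) + 1) * s"
  using assms(2)
proof (induction q)
  case 0
  from 0[of 0] show ?case by simp
next
  case (pCons c q)
  have c: "cmod c \<le> s" using pCons.prems[of 0] by simp
  have q: "norm (cpoly_at q w) \<le> (real (degree q) + 1) * s"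
    using pCons.prems[of "Suc _"] by (intro pCons.IH) simp
  have wq: "norm (w * cpoly_at q w) \<le> norm (cpoly_at q w)"
    using norm_mult_ineq[of w "cpoly_at q w"] assms(1) mult_right_mono[of "norm w" 1 "norm (cpoly_at q w)"]
    by simp
  have "norm (cpoly_at (pCons c q) w) \<le> norm (c *\<^sub>C (1::'a)) + norm (w * cpoly_at q w)"
    by (simp add: norm_triangle_ineq)
  then have le: "norm (cpoly_at (pCons c q) w) \<le> s + norm (cpoly_at q w)"
    using c wq by (simp add: norm_scaleC)
  show ?case
  proof (cases "q = 0")
    case True
    then show ?thesis using le by simp
  next
    case False
    then show ?thesis using le q by (simp add: algebra_simps)
  qed
qed

text \<open>The coefficients are Fourier coefficients: average \<open>poly q\<close> against powers over the \<open>n\<close>-th roots of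
  unity, with \<open>n\<close> exceeding the degree.\<close>

lemma coeff_le_sup_circle:
  fixes q :: "complex poly"
  assumes "\<And>z. cmod z = 1 \<Longrightarrow> cmod (poly q z) \<le> s"
  shows "cmod (coeff q j) \<le> s"
proof -
  define n where "n = Suc (max j (degree q))"
  define \<omega> where "\<omega> k = cis (2 * pi * real k / real n)" for k
  have n: "n > 0" "j < n" "degree q < n" by (auto simp: n_def)
  have inj: "inj_on \<omega> {..<n}"
    using Complex.bij_betw_roots_unity[OF n(1)] unfolding \<omega>_def bij_betw_def by blast
  have pow: "\<omega> k ^ i = \<omega> i ^ k" for i k
    by (simp add: \<omega>_def Complex.DeMoivre mult_ac)
  have cmod: "cmod (\<omega> k) = 1" for k by (simp add: \<omega>_def)
  have root: "\<omega> i ^ n = 1" for i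
    using n by (simp add: \<omega>_def Complex.DeMoivre)
  have orth: "(\<Sum>k<n. (\<omega> i * cnj (\<omega> j)) ^ k) = (if i = j then of_nat n else 0)" if "i < n" for i
  proof (cases "i = j")
    case True
    then show ?thesis using cmod[of j] by (simp add: complex_norm_square[symmetric] flip: of_real_power)
  next
    case False
    have "\<omega> i * cnj (\<omega> j) \<noteq> 1"
    proof
      assume "\<omega> i * cnj (\<omega> j) = 1"
      then have "\<omega> i * (cnj (\<omega> j) * \<omega> j) = \<omega> j" by (metis mult.assoc mult_1)
      then have "\<omega> i = \<omega> j" using cmod[of j]
        by (simp add: mult.commute[of "cnj _"] complex_norm_square[symmetric])
      then show False using inj False that n(2) by (auto dest: inj_onD)
    qed
    moreover have "(\<omega> i * cnj (\<omega> j)) ^ n = 1"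
      using root by (simp add: power_mult_distrib flip: complex_cnj_power)
    ultimately show ?thesis using False by (simp add: sum_gp_strict)
  qed
  have "(\<Sum>k<n. poly q (\<omega> k) * cnj (\<omega> k) ^ j)
      = (\<Sum>k<n. \<Sum>i<n. coeff q i * (\<omega> i * cnj (\<omega> j)) ^ k)"
  proof (rule sum.cong[OF refl])
    fix k
    have "poly q (\<omega> k) = (\<Sum>i<n. coeff q i * \<omega> k ^ i)"
      unfolding poly_altdef using n(3)
      by (intro sum.mono_neutral_left) (auto simp: coeff_eq_0)
    then show "poly q (\<omega> k) * cnj (\<omega> k) ^ j = (\<Sum>i<n. coeff q i * (\<omega> i * cnj (\<omega> j)) ^ k)"
      by (simp add: sum_distrib_right power_mult_distrib pow[of k] mult.assoc flip: complex_cnj_power)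
  qed
  also have "\<dots> = (\<Sum>i<n. coeff q i * (\<Sum>k<n. (\<omega> i * cnj (\<omega> j)) ^ k))"
    by (subst sum.swap) (simp add: sum_distrib_left)
  also have "\<dots> = (\<Sum>i<n. if i = j then coeff q j * of_nat n else 0)"
    by (rule sum.cong) (auto simp: orth)
  also have "\<dots> = coeff q j * of_nat n" using n(2) by simp
  finally have "real n * cmod (coeff q j) = cmod (\<Sum>k<n. poly q (\<omega> k) * cnj (\<omega> k) ^ j)"
    by (simp add: norm_mult)
  also have "\<dots> \<le> (\<Sum>k<n. s)"
    by (intro sum_norm_le) (simp add: norm_mult norm_power cmod assms)
  finally show ?thesis using n(1) by simp
qed

text \<open>If \<open>a\<close> is the real part of a unitary \<open>w\<close>, then a polynomial of \<open>a\<close> is a Laurent polynomial of \<open>w\<close>,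
  and the same Laurent polynomial expresses \<open>poly p (Re z)\<close> on the unit circle. So the coefficients
  of \<open>q\<close> are controlled by the supremum of \<open>p\<close> on \<open>[-1, 1]\<close>. The factor \<open>w ^ degree p\<close> clears the
  negative powers.\<close>

lemma poly_at_unitary_real_part:
  fixes w :: "'a::{complex_algebra, real_algebra_1}"
  assumes w: "w * w' = 1" and a: "a = (1/2) *\<^sub>R (w + w')"
  shows "\<exists>q. degree q \<le> 2 * degree p \<and>
    (\<forall>z. cmod z = 1 \<longrightarrow> poly q z = z ^ degree p * complex_of_real (poly p (Re z))) \<and>
    cpoly_at q w = w ^ degree p * poly_at p a"
proof (induction p)
  case 0
  show ?case by (intro exI[of _ 0]) simp
next
  case (pCons c p)
  show ?case
  proof (cases "p = 0")
    case True
    then show ?thesis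
      by (intro exI[of _ "[:complex_of_real c:]"]) (simp add: of_real_def scaleR_scaleC)
  next
    case False
    from pCons.IH obtain q where q: "degree q \<le> 2 * degree p"
      "\<And>z. cmod z = 1 \<Longrightarrow> poly q z = z ^ degree p * complex_of_real (poly p (Re z))"
      "cpoly_at q w = w ^ degree p * poly_at p a" by blast
    let ?d = "degree p"
    let ?q = "monom (complex_of_real c) (Suc ?d) + smult (1/2) (q + pCons 0 (pCons 0 q))"
    have "degree ?q \<le> 2 * Suc ?d"
    proof (intro degree_add_le)
      show "degree (monom (complex_of_real c) (Suc ?d)) \<le> 2 * Suc ?d"
        by (rule order.trans[OF degree_monom_le]) simp
      have "degree (q + pCons 0 (pCons 0 q)) \<le> 2 * Suc ?d"
      proof (intro degree_add_le)
        show "degree (pCons 0 (pCons 0 q)) \<le> 2 * Suc ?d"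
          by (rule order.trans[OF degree_pCons_le]) (use order.trans[OF degree_pCons_le[of 0 q] Suc_le_mono[THEN iffD2, OF q(1)]] in simp)
      qed (use q(1) in simp)
      then show "degree (smult (1/2) (q + pCons 0 (pCons 0 q))) \<le> 2 * Suc ?d"
        using degree_smult_le[of "1/2" "q + pCons 0 (pCons 0 q)"] by linarith
    qed
    moreover have "poly ?q z = z ^ Suc ?d * complex_of_real (poly (pCons c p) (Re z))"
      if z: "cmod z = 1" for z
    proof -
      have "z * cnj z = 1" using z by (simp add: complex_norm_square[symmetric])
      moreover have "complex_of_real (Re z) = (z + cnj z) / 2"
        by (simp add: complex_add_cnj)
      ultimately have z2: "z * complex_of_real (Re z) = (1 + z * z) / 2"
        by (simp add: algebra_simps)
      have "poly ?q z = z ^ Suc ?d * c + ((1 + z * z) / 2) * (z ^ ?d * poly p (Re z))"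
        by (simp add: q(2)[OF z] poly_monom algebra_simps add_divide_distrib)
      also have "\<dots> = z ^ Suc ?d * complex_of_real (poly (pCons c p) (Re z))"
        unfolding z2[symmetric] by (simp add: algebra_simps)
      finally show ?thesis .
    qed
    moreover have "cpoly_at ?q w = w ^ Suc ?d * poly_at (pCons c p) a"
    proof -
      have wa: "w * a = (1/2) *\<^sub>R (1 + w * w)"
        by (simp add: a w algebra_simps)
      have "cpoly_at ?q w = c *\<^sub>R w ^ Suc ?d + (1/2) *\<^sub>R (w ^ ?d * poly_at p a + w * (w * (w ^ ?d * poly_at p a)))"
        by (simp add: cpoly_at_add cpoly_at_smult cpoly_at_monom q(3) scaleR_scaleC)
      also have "w * (w * (w ^ ?d * poly_at p a)) = w ^ ?d * (w * w) * poly_at p a"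
      proof -
        have "w * (w * w ^ ?d) = w ^ ?d * (w * w)"
          by (metis power_commutes mult.assoc)
        then show ?thesis by (simp flip: mult.assoc)
      qed
      also have "c *\<^sub>R w ^ Suc ?d + (1/2) *\<^sub>R (w ^ ?d * poly_at p a + w ^ ?d * (w * w) * poly_at p a)
          = c *\<^sub>R w ^ Suc ?d + w ^ ?d * (w * a) * poly_at p a"
        unfolding wa by (simp add: algebra_simps)
      also have "\<dots> = w ^ Suc ?d * poly_at (pCons c p) a"
        by (simp add: distrib_left of_real_def power_Suc2 mult.assoc del: power_Suc)
      finally show ?thesis .
    qed
    ultimately show ?thesis using False by (intro exI[of _ ?q]) simp
  qed
qed


text \<open>The recursion multiplies by \<open>(1/2 - n) / (n + 1)\<close>, whose modulus is at most one. So the binomial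
  series for \<open>\<surd>(1 - a)\<close> converges absolutely as soon as \<open>\<parallel>a\<parallel> < 1\<close>.\<close>

lemma abs_half_gchoose_le: "\<bar>(1/2 :: real) gchoose n\<bar> \<le> 1"
proof (induction n)
  case (Suc n)
  have "\<bar>(1/2 :: real) gchoose (Suc n)\<bar> = \<bar>(1/2 :: real) gchoose n\<bar> * (\<bar>1/2 - real n\<bar> / real (Suc n))"
    by (simp add: gbinomial_Suc_rec[of "1/2"] abs_mult gbinomial_absorption)
  also have "\<dots> \<le> 1 * 1"
    by (intro mult_mono Suc.IH) (auto simp: field_simps abs_if)
  finally show ?case by simp
qed simp

text \<open>The Cauchy square of the binomial series collapses to \<open>1 - a\<close> by the Vandermonde identity
  \<open>\<Sum>\<^sub>i (1/2 gchoose i) (1/2 gchoose k - i) = (1 gchoose k)\<close>. As a limit of real polynomials of \<open>a\<close>, the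
  root is self-adjoint with \<open>a\<close> and commutes with whatever commutes with \<open>a\<close>.\<close>

lemma sqrt_one_minus:
  fixes a :: "'a::{cstar_algebra, real_normed_algebra_1}"
  assumes "norm a < 1"
  obtains s where "s * s = 1 - a" and "star a = a \<Longrightarrow> star s = s"
    and "\<And>c. c * a = a * c \<Longrightarrow> c * s = s * c"
proof -
  define u where "u n = (((1/2 :: real) gchoose n) * (-1) ^ n) *\<^sub>R a ^ n" for n
  have "norm (u n) \<le> norm a ^ n" for n
  proof -
    have "norm (u n) = \<bar>(1/2 :: real) gchoose n\<bar> * norm (a ^ n)"
      by (simp add: u_def abs_mult power_abs)
    also have "\<dots> \<le> 1 * norm a ^ n"
      by (intro mult_mono abs_half_gchoose_le norm_power_ineq) auto
    finally show ?thesis by simp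
  qed
  then have sum: "summable (\<lambda>n. norm (u n))"
    using assms by (intro summable_comparison_test'[OF summable_geometric[of "norm a"]]) auto
  then have sums: "u sums suminf u" by (simp add: summable_norm_cancel summable_sums)
  have "(\<lambda>k. \<Sum>i\<le>k. u i * u (k - i)) sums (suminf u * suminf u)"
    by (rule Cauchy_product_sums[OF sum sum])
  moreover have "(\<Sum>i\<le>k. u i * u (k - i)) = (((1::real) gchoose k) * (-1) ^ k) *\<^sub>R a ^ k" for k
  proof -
    have "(\<Sum>i\<le>k. u i * u (k - i))
        = (\<Sum>i\<in>{0..k}. (((1/2) gchoose i) * ((1/2) gchoose (k - i)) * (-1) ^ k) *\<^sub>R a ^ k)"
      unfolding atMost_atLeast0
    proof (rule sum.cong)
      fix i assume "i \<in> {0..k}"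
      then have "(-1 :: real) ^ k = (-1) ^ i * (-1) ^ (k - i)" "a ^ k = a ^ i * a ^ (k - i)"
        by (simp_all flip: power_add)
      then show "u i * u (k - i) = (((1/2) gchoose i) * ((1/2) gchoose (k - i)) * (-1) ^ k) *\<^sub>R a ^ k"
        by (simp add: u_def mult_ac)
    qed simp
    also have "\<dots> = ((\<Sum>i\<in>{0..k}. ((1/2) gchoose i) * ((1/2) gchoose (k - i))) * (-1) ^ k) *\<^sub>R a ^ k"
      by (simp add: scaleR_sum_left sum_distrib_right)
    finally show ?thesis by (simp add: gbinomial_Vandermonde)
  qed
  ultimately have prod: "(\<lambda>k. (((1::real) gchoose k) * (-1) ^ k) *\<^sub>R a ^ k) sums (suminf u * suminf u)"
    by simp
  \<comment> \<open>The binomial series of exponent one stops after the linear term.\<close>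
  have "(1::real) gchoose k = 0" if "k > 1" for k
    using binomial_gbinomial[of 1 k, where 'a = real] that by (simp add: binomial_eq_0)
  then have "(\<lambda>k. (((1::real) gchoose k) * (-1) ^ k) *\<^sub>R a ^ k)
      sums (\<Sum>k\<in>{0,1}. (((1::real) gchoose k) * (-1) ^ k) *\<^sub>R a ^ k)"
    by (intro sums_finite) auto
  with prod have "suminf u * suminf u = (\<Sum>k\<in>{0,1}. (((1::real) gchoose k) * (-1) ^ k) *\<^sub>R a ^ k)"
    by (rule sums_unique2)
  then have "suminf u * suminf u = 1 - a" by simp
  moreover have "star (suminf u) = suminf u" if "star a = a"
  proof -
    have "(\<lambda>n. star (u n)) sums star (suminf u)"
      by (rule bounded_linear.sums[OF bounded_linear_star sums])
    moreover have "(\<lambda>n. star (u n)) = u"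
      by (simp add: fun_eq_iff u_def star_scaleR star_power that)
    ultimately have "u sums star (suminf u)" by simp
    with sums show ?thesis by (metis sums_unique2)
  qed
  moreover have "c * suminf u = suminf u * c" if c: "c * a = a * c" for c
  proof -
    have "c * a ^ n = a ^ n * c" for n
      using power_commuting_commutes[of a c n] c by simp
    then have "c * u n = u n * c" for n by (simp add: u_def)
    then have "(\<lambda>n. c * u n) sums (suminf u * c)"
      using sums_mult2[OF sums, of c] by simp
    with sums_mult[OF sums, of c] show ?thesis by (rule sums_unique2)
  qed
  ultimately show ?thesis using that by blast
qed

text \<open>For self-adjoint elements the norm is the spectral radius; this is the form in which that is used.\<close>

lemma norm_power_two_power:
  assumes "star b = b"
  shows "norm (b ^ (2 ^ n)) = norm (b :: 'a::{cstar_algebra, real_normed_algebra_1}) ^ (2 ^ n)"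
proof (induction n)
  case (Suc n)
  have "star (b ^ 2 ^ n) = b ^ 2 ^ n" by (simp add: star_power assms)
  then have "norm (b ^ 2 ^ n * b ^ 2 ^ n) = (norm (b ^ 2 ^ n))\<^sup>2"
    by (metis cstar_identity)
  then show ?case
    by (simp add: Suc mult_2 power_add power2_eq_square)
qed simp

lemma le_of_subexponential_bound:
  fixes x s :: real
  assumes "x \<ge> 0" "s \<ge> 0" and bound: "\<And>n. x ^ (2 ^ n) \<le> (2 * real d * 2 ^ n + 1) * s ^ (2 ^ n)"
  shows "x \<le> s"
proof (rule ccontr)
  assume "\<not> x \<le> s"
  then have less: "s < x" by simp
  show False
  proof (cases "s = 0")
    case True
    then show ?thesis using bound[of 0] less by simp
  next
    case False
    define r where "r = x / s"
    have r: "r > 1" using False less assms by (simp add: r_def)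
    have le: "1 / (2 * real d + 1) \<le> real (2 ^ n) / r ^ (2 ^ n)" for n
    proof -
      have "r ^ (2 ^ n) \<le> 2 * real d * 2 ^ n + 1"
        using bound[of n] False assms(2) by (simp add: r_def power_divide field_simps)
      also have "\<dots> \<le> (2 * real d + 1) * 2 ^ n" by (simp add: algebra_simps)
      finally show ?thesis using r by (simp add: field_simps)
    qed
    have "(\<lambda>n. of_nat n / r ^ n) \<longlonglongrightarrow> 0"
      using lim_n_over_pown[of r] r by simp
    moreover have "strict_mono (\<lambda>n::nat. (2::nat) ^ n)"
      by (simp add: strict_mono_def)
    ultimately have "(\<lambda>n. real (2 ^ n) / r ^ (2 ^ n)) \<longlonglongrightarrow> 0"
      using LIMSEQ_subseq_LIMSEQ[of "\<lambda>n. of_nat n / r ^ n" 0 "\<lambda>n. 2 ^ n"] by (simp add: o_def)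
    then have "1 / (2 * real d + 1) \<le> 0"
      using le by (intro LIMSEQ_le_const) auto
    then show False by (simp add: field_simps)
  qed
qed

text \<open>The element \<open>a\<close> is the real part of the unitary \<open>w = a + i \<surd>(1 - a\<^sup>2)\<close>. Bounding the coefficients of
  the Laurent polynomial of \<open>w\<close> yields the estimate \<open>\<parallel>q(a)\<parallel> \<le> (2 deg q + 1) sup |q|\<close>. Applied to
  \<open>q = p ^ (2 ^ n)\<close>, whose degree grows only linearly in the exponent, and compared with
  \<open>\<parallel>p(a) ^ (2 ^ n)\<parallel> = \<parallel>p(a)\<parallel> ^ (2 ^ n)\<close>, it loses the factor in the limit.\<close>

lemma norm_poly_at_le_unit:
  fixes a :: "'a::{cstar_algebra, real_normed_algebra_1}"
  assumes sa: "star a = a" and less: "norm a < 1"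
    and bound: "\<And>t. \<bar>t\<bar> \<le> 1 \<Longrightarrow> \<bar>poly p t\<bar> \<le> S"
  shows "norm (poly_at p a) \<le> S"
proof -
  have "norm (a * a) < 1"
    using less norm_mult_ineq[of a a] mult_mono[of "norm a" 1 "norm a" "norm a"] by simp
  then obtain s where s: "s * s = 1 - a * a" "star s = s" "a * s = s * a"
    using sqrt_one_minus[of "a * a"] sa by (metis mult.assoc star_mult)
  define w where "w = a + \<i> *\<^sub>C s"
  have star_w: "star w = a - \<i> *\<^sub>C s"
    by (simp add: w_def star_add star_scaleC sa s)
  \<comment> \<open>The unitary with real part \<open>a\<close> and imaginary part \<open>s\<close>.\<close>
  have ww: "w * star w = 1" "star w * w = 1"
    unfolding star_w unfolding w_def
    by (simp_all add: algebra_simps mult_scaleC_left mult_scaleC_right scaleC_scaleC s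
        flip: scaleR_scaleC)
  have a: "a = (1/2) *\<^sub>R (w + star w)"
  proof -
    have "w + star w = 2 *\<^sub>R a" unfolding star_w unfolding w_def by (simp add: scaleR_2)
    then show ?thesis by simp
  qed
  have w1: "norm w = 1"
    using cstar_identity[of w] by (simp add: ww power2_eq_1_iff) (use norm_ge_zero[of w] in linarith)
  have S: "S \<ge> 0" using bound[of 0] by simp
  have crude: "norm (poly_at q a) \<le> (2 * real (degree q) + 1) * M"
    if M: "\<And>t. \<bar>t\<bar> \<le> 1 \<Longrightarrow> \<bar>poly q t\<bar> \<le> M" for q M
  proof -
    obtain Q where Q: "degree Q \<le> 2 * degree q"
      "\<And>z. cmod z = 1 \<Longrightarrow> poly Q z = z ^ degree q * complex_of_real (poly q (Re z))"
      "cpoly_at Q w = w ^ degree q * poly_at q a"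
      using poly_at_unitary_real_part[OF ww(1) a, of q] by blast
    have "cmod (coeff Q j) \<le> M" for j
    proof (rule coeff_le_sup_circle)
      fix z :: complex assume z: "cmod z = 1"
      then have "\<bar>Re z\<bar> \<le> 1" using abs_Re_le_cmod[of z] by simp
      then show "cmod (poly Q z) \<le> M" using z by (simp add: Q(2) norm_mult norm_power M)
    qed
    then have "norm (cpoly_at Q w) \<le> (real (degree Q) + 1) * M"
      using w1 by (intro norm_cpoly_at_le) auto
    moreover have "star w ^ degree q * cpoly_at Q w = poly_at q a"
    proof -
      have "star w ^ n * w ^ n = 1" for n
      proof (induction n)
        case (Suc n)
        have "star w ^ Suc n * w ^ Suc n = star w ^ n * (star w * w) * w ^ n"
          by (metis power_Suc power_Suc2 mult.assoc)
        then show ?case using Suc ww by simp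
      qed simp
      then show ?thesis unfolding Q(3) by (simp flip: mult.assoc)
    qed
    moreover have "norm (star w ^ degree q * cpoly_at Q w) \<le> norm (cpoly_at Q w)"
    proof -
      have "norm (star w ^ degree q) \<le> 1"
        using norm_power_ineq[of "star w" "degree q"] w1 by simp
      then show ?thesis
        using norm_mult_ineq[of "star w ^ degree q" "cpoly_at Q w"]
          mult_right_mono[of "norm (star w ^ degree q)" 1 "norm (cpoly_at Q w)"] by simp
    qed
    moreover have "(real (degree Q) + 1) * M \<le> (2 * real (degree q) + 1) * M"
      using Q(1) M[of 0] by (intro mult_right_mono) auto
    ultimately show ?thesis by simp
  qed
  show ?thesis
  proof (rule le_of_subexponential_bound[OF norm_ge_zero S])
    fix n
    let ?q = "p ^ (2 ^ n)"
    have "norm (poly_at ?q a) \<le> (2 * real (degree ?q) + 1) * S ^ (2 ^ n)"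
      using bound by (intro crude) (auto simp: poly_power power_abs intro!: power_mono)
    also have "\<dots> \<le> (2 * real (degree p) * 2 ^ n + 1) * S ^ (2 ^ n)"
    proof (intro mult_right_mono)
      have "real (degree ?q) \<le> real (degree p * 2 ^ n)"
        using degree_power_le[of p "2 ^ n"] of_nat_le_iff by blast
      then show "2 * real (degree ?q) + 1 \<le> 2 * real (degree p) * 2 ^ n + 1" by simp
    qed (simp add: S)
    finally show "norm (poly_at p a) ^ 2 ^ n \<le> (2 * real (degree p) * 2 ^ n + 1) * S ^ 2 ^ n"
      by (simp add: poly_at_power norm_power_two_power star_poly_at sa)
  qed
qed

text \<open>Rescaling reduces this to norm below one, applied to \<open>c a\<close> with \<open>c < 1\<close>; then \<open>c\<close> tends to \<open>1\<close>. The
  bound is needed exactly on \<open>[- \<parallel>a\<parallel>, \<parallel>a\<parallel>]\<close> because the order theory below compares norms sharply.\<close>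

theorem norm_poly_at_le:
  fixes a :: "'a::{cstar_algebra, real_normed_algebra_1}"
  assumes sa: "star a = a" and bound: "\<And>t. \<bar>t\<bar> \<le> norm a \<Longrightarrow> \<bar>poly p t\<bar> \<le> S"
  shows "norm (poly_at p a) \<le> S"
proof (cases "a = 0")
  case True
  then show ?thesis using bound[of 0] by (simp add: poly_at_zero)
next
  case False
  define R where "R = norm a"
  have R: "R > 0" using False by (simp add: R_def)
  define c where "c n = 1 - inverse (real (Suc n))" for n
  have c: "0 \<le> c n" "c n < 1" for n by (auto simp: c_def field_simps)
  have "c \<longlonglongrightarrow> 1 - 0" unfolding c_def by (intro tendsto_intros LIMSEQ_inverse_real_of_nat)
  then have "(\<lambda>n. poly_at p (c n *\<^sub>R a)) \<longlonglongrightarrow> poly_at p (1 *\<^sub>R a)"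
    by (intro tendsto_poly_at tendsto_intros) simp
  then have lim: "(\<lambda>n. norm (poly_at p (c n *\<^sub>R a))) \<longlonglongrightarrow> norm (poly_at p a)"
    by (intro tendsto_norm) simp
  have "norm (poly_at p (c n *\<^sub>R a)) \<le> S" for n
  proof -
    have "norm (poly_at (pcompose p [:0, R:]) ((c n / R) *\<^sub>R a)) \<le> S"
    proof (rule norm_poly_at_le_unit)
      show "star ((c n / R) *\<^sub>R a) = (c n / R) *\<^sub>R a" by (simp add: star_scaleR sa)
      show "norm ((c n / R) *\<^sub>R a) < 1" using R c[of n] by (simp add: R_def)
      show "\<bar>poly (pcompose p [:0, R:]) t\<bar> \<le> S" if "\<bar>t\<bar> \<le> 1" for t
      proof -
        have "\<bar>R * t\<bar> \<le> norm a" using that R by (simp add: abs_mult R_def)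
        then show ?thesis using bound[of "R * t"] by (simp add: poly_pcompose mult.commute)
      qed
    qed
    then show ?thesis using R by (simp add: poly_at_pcompose)
  qed
  then show ?thesis using lim by (intro LIMSEQ_le_const2) auto
qed

section \<open>Continuous functional calculus of a self-adjoint element\<close>

text \<open>The value \<open>f(a)\<close> is pinned down by its distance from polynomials of \<open>a\<close>; taking all \<open>p\<close> at once
  avoids a choice of an approximating sequence in the definition.\<close>

definition is_cfc :: "'a::{cstar_algebra, real_normed_algebra_1} \<Rightarrow> (real \<Rightarrow> real) \<Rightarrow> 'a \<Rightarrow> bool" where
  "is_cfc a f x \<longleftrightarrow> (\<forall>p e. (\<forall>t. \<bar>t\<bar> \<le> norm a \<longrightarrow> \<bar>f t - poly p t\<bar> \<le> e) \<longrightarrow> norm (x - poly_at p a) \<le> e)"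

definition cfc :: "'a::{cstar_algebra, real_normed_algebra_1} \<Rightarrow> (real \<Rightarrow> real) \<Rightarrow> 'a" where
  "cfc a f = (SOME x. is_cfc a f x)"

lemma poly_at_diff: "poly_at (p - q) a = poly_at p a - poly_at q a"
  using poly_at_add[of "p - q" q a] by (simp add: eq_diff_eq)

lemma poly_approximation:
  fixes f :: "real \<Rightarrow> real"
  assumes f: "continuous_on UNIV f"
  obtains P :: "nat \<Rightarrow> real poly" where "uniform_limit {- R..R} (\<lambda>n. poly (P n)) f sequentially"
proof -
  have "\<exists>p. \<forall>t\<in>{- R..R}. \<bar>f t - poly p t\<bar> < inverse (real (Suc n))" for n
  proof -
    obtain g where g: "real_polynomial_function g"
      "\<And>t. t \<in> {- R..R} \<Longrightarrow> \<bar>f t - g t\<bar> < inverse (real (Suc n))"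
      using Stone_Weierstrass_real_polynomial_function[of "{- R..R}" f "inverse (real (Suc n))"]
        continuous_on_subset[OF f] by auto
    obtain c m where "g = (\<lambda>x. \<Sum>i\<le>m. c i * x ^ i)"
      using g(1) by (auto simp: real_polynomial_function_iff_sum)
    then have "g t = poly (\<Sum>i\<le>m. monom (c i) i) t" for t
      by (simp add: poly_sum poly_monom)
    then show ?thesis using g(2) by metis
  qed
  then obtain P where P: "\<And>n t. t \<in> {- R..R} \<Longrightarrow> \<bar>f t - poly (P n) t\<bar> < inverse (real (Suc n))"
    by metis
  have "uniform_limit {- R..R} (\<lambda>n. poly (P n)) f sequentially"
  proof (rule uniform_limitI)
    fix e :: real assume "e > 0"
    then obtain N where N: "N > 0" "inverse (real N) < e" using ex_inverse_of_nat_less by blast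
    have "dist (poly (P n) t) (f t) < e" if "n \<ge> N" "t \<in> {- R..R}" for n t
    proof -
      have "inverse (real (Suc n)) \<le> inverse (real N)"
        using that(1) N(1) by (intro le_imp_inverse_le) auto
      then show ?thesis using P[OF that(2), of n] N(2) by (simp add: dist_real_def abs_minus_commute)
    qed
    then show "\<forall>\<^sub>F n in sequentially. \<forall>t\<in>{- R..R}. dist (poly (P n) t) (f t) < e"
      unfolding eventually_sequentially by blast
  qed
  then show ?thesis by (rule that)
qed

lemma uniform_limit_eventually_le:
  fixes f :: "real \<Rightarrow> real"
  assumes "uniform_limit {- R..R} g f sequentially" and "e > 0"
  shows "\<forall>\<^sub>F n in sequentially. \<forall>t. \<bar>t\<bar> \<le> R \<longrightarrow> \<bar>f t - g n t\<bar> \<le> e"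
  using uniform_limitD[OF assms]
proof eventually_elim
  case (elim n)
  show ?case
  proof (intro allI impI)
    fix t assume "\<bar>t\<bar> \<le> R"
    then have "t \<in> {- R..R}" by auto
    with elim show "\<bar>f t - g n t\<bar> \<le> e" by (fastforce simp: dist_real_def)
  qed
qed

lemma ex_is_cfc:
  fixes a :: "'a::{cstar_algebra, real_normed_algebra_1}"
  assumes sa: "star a = a" and f: "continuous_on UNIV f"
  shows "\<exists>x. is_cfc a f x"
proof -
  obtain P where P: "uniform_limit {- norm a..norm a} (\<lambda>n. poly (P n)) f sequentially"
    using poly_approximation[OF f] by blast
  have "Cauchy (\<lambda>n. poly_at (P n) a)"
  proof (rule CauchyI)
    fix e :: real assume "0 < e"
    then have "e / 3 > 0" by simp
    from uniform_limit_eventually_le[OF P this] obtain N where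
      N: "\<And>n t. n \<ge> N \<Longrightarrow> \<bar>t\<bar> \<le> norm a \<Longrightarrow> \<bar>f t - poly (P n) t\<bar> \<le> e / 3"
      by (auto simp: eventually_sequentially)
    have "norm (poly_at (P m) a - poly_at (P n) a) < e" if "m \<ge> N" "n \<ge> N" for m n
    proof -
      have "norm (poly_at (P m - P n) a) \<le> 2 * (e / 3)"
      proof (rule norm_poly_at_le[OF sa])
        fix t :: real assume "\<bar>t\<bar> \<le> norm a"
        then show "\<bar>poly (P m - P n) t\<bar> \<le> 2 * (e / 3)"
          using N[OF that(1), of t] N[OF that(2), of t] unfolding poly_diff by linarith
      qed
      then show ?thesis using \<open>e > 0\<close> by (simp add: poly_at_diff)
    qed
    then show "\<exists>M. \<forall>m\<ge>M. \<forall>n\<ge>M. norm (poly_at (P m) a - poly_at (P n) a) < e" by blast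
  qed
  then obtain x where x: "(\<lambda>n. poly_at (P n) a) \<longlonglongrightarrow> x"
    by (auto simp: Cauchy_convergent_iff convergent_def)
  have "is_cfc a f x" unfolding is_cfc_def
  proof (intro allI impI)
    fix p e assume p: "\<forall>t. \<bar>t\<bar> \<le> norm a \<longrightarrow> \<bar>f t - poly p t\<bar> \<le> e"
    show "norm (x - poly_at p a) \<le> e"
    proof (rule field_le_epsilon)
      fix d :: real assume d: "d > 0"
      have "\<forall>\<^sub>F n in sequentially. norm (poly_at (P n) a - poly_at p a) \<le> e + d"
        using uniform_limit_eventually_le[OF P d]
      proof eventually_elim
        case (elim n)
        have "norm (poly_at (P n - p) a) \<le> e + d"
        proof (rule norm_poly_at_le[OF sa])
          fix t :: real assume "\<bar>t\<bar> \<le> norm a"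
          then show "\<bar>poly (P n - p) t\<bar> \<le> e + d"
            using elim p by (simp add: abs_le_iff) (smt (verit))
        qed
        then show ?case by (simp add: poly_at_diff)
      qed
      then show "norm (x - poly_at p a) \<le> e + d"
        by (intro tendsto_upperbound[OF tendsto_norm[OF tendsto_diff[OF x tendsto_const]]]) auto
    qed
  qed
  then show ?thesis ..
qed

lemma cfc_approx:
  assumes "star a = a" and "continuous_on UNIV f"
    and "\<And>t. \<bar>t\<bar> \<le> norm a \<Longrightarrow> \<bar>f t - poly p t\<bar> \<le> e"
  shows "norm (cfc a f - poly_at p a) \<le> e"
  using someI_ex[OF ex_is_cfc[OF assms(1,2)]] assms(3) by (simp add: cfc_def is_cfc_def)

lemma cfc_tendsto:
  assumes "star a = a" and "continuous_on UNIV f"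
    and "uniform_limit {- norm a..norm a} (\<lambda>n. poly (P n)) f sequentially"
  shows "(\<lambda>n. poly_at (P n) a) \<longlonglongrightarrow> cfc a f"
proof (rule tendstoI)
  fix e :: real assume e: "e > 0"
  then have "e / 2 > 0" by simp
  from uniform_limit_eventually_le[OF assms(3) this]
  show "\<forall>\<^sub>F n in sequentially. dist (poly_at (P n) a) (cfc a f) < e"
  proof eventually_elim
    case (elim n)
    then have "norm (cfc a f - poly_at (P n) a) \<le> e / 2"
      by (intro cfc_approx assms) auto
    then show ?case using e by (simp add: dist_norm norm_minus_commute)
  qed
qed

text \<open>Every identity below is true for polynomials and passes to uniform limits.\<close>

lemma cfc_poly: "star a = a \<Longrightarrow> cfc a (poly p) = poly_at p a"
  using cfc_approx[of a "poly p" p 0] by (simp add: continuous_on_poly)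

lemma cfc_const: "star a = a \<Longrightarrow> cfc a (\<lambda>t. c) = of_real c"
proof -
  assume "star a = a"
  moreover have "poly [:c:] = (\<lambda>t. c)" by auto
  ultimately show ?thesis using cfc_poly[of a "[:c:]"] by simp
qed

lemma cfc_ident: "star a = a \<Longrightarrow> cfc a (\<lambda>t. t) = a"
proof -
  assume "star a = a"
  moreover have "poly [:0, 1:] = (\<lambda>t::real. t)" by auto
  ultimately show ?thesis using cfc_poly[of a "[:0, 1:]"] by simp
qed

lemma cfc_cong:
  assumes "star a = a" "continuous_on UNIV f" "continuous_on UNIV g"
    and "\<And>t. \<bar>t\<bar> \<le> norm a \<Longrightarrow> f t = g t"
  shows "cfc a f = cfc a g"
proof -
  obtain P where P: "uniform_limit {- norm a..norm a} (\<lambda>n. poly (P n)) f sequentially"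
    using poly_approximation[OF assms(2)] by blast
  moreover have "uniform_limit {- norm a..norm a} (\<lambda>n. poly (P n)) g sequentially"
    using P by (rule uniform_limit_cong'[THEN iffD1, rotated 2]) (auto intro!: assms(4))
  ultimately show ?thesis using cfc_tendsto assms LIMSEQ_unique by metis
qed

lemma norm_cfc_le:
  assumes sa: "star a = a" and f: "continuous_on UNIV f" and "\<And>t. \<bar>t\<bar> \<le> norm a \<Longrightarrow> \<bar>f t\<bar> \<le> s"
  shows "norm (cfc a f) \<le> s"
  using cfc_approx[OF sa f, of 0 s] assms(3) by simp

lemma star_cfc:
  assumes sa: "star a = a" and f: "continuous_on UNIV f"
  shows "star (cfc a f) = cfc a f"
proof -
  obtain P where P: "uniform_limit {- norm a..norm a} (\<lambda>n. poly (P n)) f sequentially"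
    using poly_approximation[OF f] by blast
  have "(\<lambda>n. star (poly_at (P n) a)) \<longlonglongrightarrow> star (cfc a f)"
    by (intro tendsto_star cfc_tendsto assms P)
  then show ?thesis
    using cfc_tendsto[OF sa f P] LIMSEQ_unique by (simp add: star_poly_at sa) blast
qed

lemma cfc_add:
  assumes "star a = a" "continuous_on UNIV f" "continuous_on UNIV g"
  shows "cfc a (\<lambda>t. f t + g t) = cfc a f + cfc a g"
proof -
  obtain P where P: "uniform_limit {- norm a..norm a} (\<lambda>n. poly (P n)) f sequentially"
    using poly_approximation[OF assms(2)] by blast
  obtain Q where Q: "uniform_limit {- norm a..norm a} (\<lambda>n. poly (Q n)) g sequentially"
    using poly_approximation[OF assms(3)] by blast
  have "uniform_limit {- norm a..norm a} (\<lambda>n. poly (P n + Q n)) (\<lambda>t. f t + g t) sequentially"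
    unfolding poly_add by (intro uniform_limit_intros P Q)
  then have "(\<lambda>n. poly_at (P n + Q n) a) \<longlonglongrightarrow> cfc a (\<lambda>t. f t + g t)"
    by (intro cfc_tendsto assms continuous_intros)
  moreover have "(\<lambda>n. poly_at (P n + Q n) a) \<longlonglongrightarrow> cfc a f + cfc a g"
    unfolding poly_at_add by (intro tendsto_intros cfc_tendsto assms P Q)
  ultimately show ?thesis by (rule LIMSEQ_unique)
qed

lemma cfc_mult:
  assumes "star a = a" "continuous_on UNIV f" "continuous_on UNIV g"
  shows "cfc a (\<lambda>t. f t * g t) = cfc a f * cfc a g"
proof -
  obtain P where P: "uniform_limit {- norm a..norm a} (\<lambda>n. poly (P n)) f sequentially"
    using poly_approximation[OF assms(2)] by blast
  obtain Q where Q: "uniform_limit {- norm a..norm a} (\<lambda>n. poly (Q n)) g sequentially"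
    using poly_approximation[OF assms(3)] by blast
  have bounded: "bounded (h ` {- norm a..norm a})" if "continuous_on UNIV h" for h :: "real \<Rightarrow> real"
    by (intro compact_imp_bounded compact_continuous_image continuous_on_subset[OF that]) auto
  have "uniform_limit {- norm a..norm a} (\<lambda>n. poly (P n * Q n)) (\<lambda>t. f t * g t) sequentially"
    unfolding poly_mult by (intro uniform_lim_mult P Q bounded assms)
  then have "(\<lambda>n. poly_at (P n * Q n) a) \<longlonglongrightarrow> cfc a (\<lambda>t. f t * g t)"
    by (intro cfc_tendsto assms continuous_intros)
  moreover have "(\<lambda>n. poly_at (P n * Q n) a) \<longlonglongrightarrow> cfc a f * cfc a g"
    unfolding poly_at_mult by (intro tendsto_intros cfc_tendsto assms P Q)
  ultimately show ?thesis by (rule LIMSEQ_unique)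
qed

lemma cfc_scale:
  assumes "star a = a" "continuous_on UNIV f"
  shows "cfc a (\<lambda>t. c * f t) = c *\<^sub>R cfc a f"
  using cfc_mult[of a "\<lambda>_. c" f] assms by (simp add: cfc_const of_real_def)

lemma cfc_minus:
  assumes "star a = a" "continuous_on UNIV f"
  shows "cfc a (\<lambda>t. - f t) = - cfc a f"
  using cfc_scale[OF assms, of "- 1"] by simp

lemma cfc_diff:
  assumes "star a = a" "continuous_on UNIV f" "continuous_on UNIV g"
  shows "cfc a (\<lambda>t. f t - g t) = cfc a f - cfc a g"
  using cfc_add[of a f "\<lambda>t. - g t"] assms by (simp add: cfc_minus continuous_intros)

lemma poly_at_cfc:
  assumes "star a = a" "continuous_on UNIV f"
  shows "poly_at p (cfc a f) = cfc a (\<lambda>t. poly p (f t))"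
proof (induction p)
  case 0
  show ?case using assms by (simp add: cfc_const)
next
  case (pCons c p)
  have cont: "continuous_on UNIV (\<lambda>t. poly p (f t))"
    by (intro continuous_intros assms)
  then have "cfc a (\<lambda>t. c + f t * poly p (f t)) = of_real c + cfc a f * cfc a (\<lambda>t. poly p (f t))"
    using assms by (subst cfc_add) (auto intro!: continuous_intros simp: cfc_mult cfc_const)
  then show ?case by (simp add: pCons)
qed

lemma cfc_compose:
  assumes sa: "star a = a" and f: "continuous_on UNIV f" and g: "continuous_on UNIV g"
  shows "cfc (cfc a f) g = cfc a (\<lambda>t. g (f t))"
proof -
  have "compact (f ` {- norm a..norm a})"
    by (intro compact_continuous_image continuous_on_subset[OF f]) auto
  then have "bounded (f ` {- norm a..norm a})" by (rule compact_imp_bounded)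
  then obtain s where "\<And>t. t \<in> {- norm a..norm a} \<Longrightarrow> \<bar>f t\<bar> \<le> s"
    unfolding bounded_iff real_norm_def by (metis imageI)
  then have s: "\<bar>f t\<bar> \<le> s" if "\<bar>t\<bar> \<le> norm a" for t
    using that by (metis abs_le_iff atLeastAtMost_iff minus_le_iff)
  have norm: "norm (cfc a f) \<le> s"
    using s by (intro norm_cfc_le sa f) auto
  obtain P where P: "uniform_limit {- s..s} (\<lambda>n. poly (P n)) g sequentially"
    using poly_approximation[OF g] by blast
  have cont: "continuous_on UNIV (\<lambda>t. g (f t))" "continuous_on UNIV (\<lambda>t. poly p (f t))" for p
    by (intro continuous_on_compose2[OF g f] continuous_intros f; simp)+
  have "(\<lambda>n. poly_at (P n) (cfc a f)) \<longlonglongrightarrow> cfc (cfc a f) g"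
    using norm by (intro cfc_tendsto star_cfc sa f g uniform_limit_on_subset[OF P]) auto
  moreover have "(\<lambda>n. poly_at (P n) (cfc a f)) \<longlonglongrightarrow> cfc a (\<lambda>t. g (f t))"
  proof (rule tendstoI)
    fix e :: real assume e: "e > 0"
    then have "e / 2 > 0" by simp
    from uniform_limit_eventually_le[OF P this]
    show "\<forall>\<^sub>F n in sequentially. dist (poly_at (P n) (cfc a f)) (cfc a (\<lambda>t. g (f t))) < e"
    proof eventually_elim
      case (elim n)
      have "norm (cfc a (\<lambda>t. g (f t) - poly (P n) (f t))) \<le> e / 2"
        using elim s by (intro norm_cfc_le sa continuous_intros cont) (auto simp: abs_le_iff)
      then have "norm (cfc a (\<lambda>t. g (f t)) - poly_at (P n) (cfc a f)) \<le> e / 2"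
        by (simp add: poly_at_cfc sa f cfc_diff cont)
      then show ?case using e by (simp add: dist_norm norm_minus_commute)
    qed
  qed
  ultimately show ?thesis by (rule LIMSEQ_unique)
qed

text \<open>With \<open>a = y y\<^sup>*\<close> and \<open>b = y\<^sup>* y\<close> this compares the two functional calculi; with \<open>a = b\<close> it says
  that \<open>f(a)\<close> commutes with the commutant of \<open>a\<close>.\<close>

lemma cfc_intertwine:
  assumes sa: "star a = a" "star b = b" and f: "continuous_on UNIV f" and ay: "a * y = y * b"
  shows "cfc a f * y = y * cfc b f"
proof -
  \<comment> \<open>One sequence of polynomials has to serve \<open>a\<close> and \<open>b\<close> simultaneously.\<close>
  define R where "R = max (norm a) (norm b)"
  obtain P where P: "uniform_limit {- R..R} (\<lambda>n. poly (P n)) f sequentially"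
    using poly_approximation[OF f] by blast
  have "(\<lambda>n. poly_at (P n) a * y) \<longlonglongrightarrow> cfc a f * y"
    by (intro tendsto_intros cfc_tendsto sa f uniform_limit_on_subset[OF P]) (auto simp: R_def)
  moreover have "(\<lambda>n. y * poly_at (P n) b) \<longlonglongrightarrow> y * cfc b f"
    by (intro tendsto_intros cfc_tendsto sa f uniform_limit_on_subset[OF P]) (auto simp: R_def)
  ultimately show ?thesis
    using LIMSEQ_unique by (simp add: poly_at_intertwine[OF ay])
qed

text \<open>A function vanishing at \<open>0\<close> does not leave an algebra without unit.\<close>

lemma cpart_cfc:
  assumes sa: "star a = a" and f: "continuous_on UNIV f" "f 0 = 0" and a: "cpart a = 0"
  shows "cpart (cfc a f) = 0"
proof -
  obtain P where P: "uniform_limit {- norm a..norm a} (\<lambda>n. poly (P n)) f sequentially"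
    using poly_approximation[OF f(1)] by blast
  have c: "cpart (poly_at p a) = complex_of_real (poly p 0)" for p
    by (induction p) (simp_all add: a of_real_def)
  have "(\<lambda>n. cpart (poly_at (P n) a)) \<longlonglongrightarrow> cpart (cfc a f)"
    by (intro bounded_linear.tendsto[OF bounded_linear_cpart] cfc_tendsto sa f P)
  moreover have "(\<lambda>n. cpart (poly_at (P n) a)) \<longlonglongrightarrow> complex_of_real (f 0)"
    unfolding c by (intro tendsto_intros tendsto_uniform_limitI[OF P]) simp
  ultimately show ?thesis using f(2) LIMSEQ_unique by fastforce
qed

section \<open>Positive elements\<close>

text \<open>The spectral notion of positivity. That it agrees with being of the form \<open>star x * x\<close> is a
  theorem (\<open>sa_square_star_mult_self\<close>); until then this a priori stronger notion is the one that is easy to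
  add and to pass to limits with.\<close>

definition sa_square :: "'a::cstar_algebra \<Rightarrow> bool" where
  "sa_square a \<longleftrightarrow> (\<exists>b. star b = b \<and> a = b * b)"

lemma sa_square_star: "sa_square a \<Longrightarrow> star a = a"
  by (auto simp: sa_square_def star_mult)

lemma sa_square_cfc:
  assumes sa: "star a = a" and f: "continuous_on UNIV f" and pos: "\<And>t. \<bar>t\<bar> \<le> norm a \<Longrightarrow> 0 \<le> f t"
  shows "sa_square (cfc a f)"
proof -
  let ?g = "\<lambda>t. sqrt (max 0 (f t))"
  have g: "continuous_on UNIV ?g" by (intro continuous_intros f)
  have "cfc a f = cfc a (\<lambda>t. ?g t * ?g t)"
    by (rule cfc_cong) (auto intro!: sa f g continuous_intros simp: pos)
  then show ?thesis
    unfolding sa_square_def by (metis cfc_mult[OF sa g g] star_cfc[OF sa g])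
qed

text \<open>Together with \<open>norm_le_if_sa_square\<close> this characterises positivity by the norm:
  the spectrum of \<open>a\<close> is nonnegative iff \<open>\<parallel>t - a\<parallel> \<le> t\<close> for large \<open>t\<close>. The norm condition is visibly
  stable under sums and limits, which is hard to see for squares.\<close>

lemma sa_square_if_norm_le:
  fixes a :: "'a::{cstar_algebra, real_normed_algebra_1}"
  assumes sa: "star a = a" and le: "norm (of_real t - a) \<le> t"
  shows "sa_square a"
proof -
  let ?c = "of_real t - a"
  have c: "star ?c = ?c" by (simp add: star_diff sa)
  have "cfc ?c (\<lambda>s. t - s) = a"
    by (simp add: cfc_diff c cfc_const cfc_ident continuous_intros)
  moreover have "sa_square (cfc ?c (\<lambda>s. t - s))"
    using le by (intro sa_square_cfc c continuous_intros) auto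
  ultimately show ?thesis by simp
qed

lemma norm_sq_sa: "star b = b \<Longrightarrow> norm (b * b) = (norm (b::'a::cstar_algebra))\<^sup>2"
  using cstar_identity[of b] by simp

lemma norm_le_if_sa_square:
  fixes a :: "'a::{cstar_algebra, real_normed_algebra_1}"
  assumes "sa_square a" and le: "norm a \<le> t"
  shows "norm (of_real t - a) \<le> t"
proof -
  obtain b where b: "star b = b" "a = b * b" using assms(1) by (auto simp: sa_square_def)
  have "norm (cfc b (\<lambda>s. t - s * s)) \<le> t"
  proof (intro norm_cfc_le b continuous_intros)
    fix s :: real assume "\<bar>s\<bar> \<le> norm b"
    then have "s * s \<le> (norm b)\<^sup>2" using abs_le_square_iff[of s "norm b"] by (simp add: power2_eq_square)
    then have "s * s \<le> t" using le b norm_sq_sa[of b] by simp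
    then show "\<bar>t - s * s\<bar> \<le> t" by simp
  qed
  then show ?thesis
    by (simp add: cfc_diff cfc_mult b cfc_const cfc_ident continuous_intros)
qed

lemma sa_square_add:
  fixes a :: "'a::{cstar_algebra, real_normed_algebra_1}"
  assumes "sa_square a" "sa_square b"
  shows "sa_square (a + b)"
proof (rule sa_square_if_norm_le)
  show "star (a + b) = a + b" using assms by (simp add: star_add sa_square_star)
  have eq: "of_real (norm a + norm b) - (a + b) = (of_real (norm a) - a) + (of_real (norm b) - b)" by simp
  show "norm (of_real (norm a + norm b) - (a + b)) \<le> norm a + norm b"
    unfolding eq
    using norm_le_if_sa_square[OF assms(1) order_refl] norm_le_if_sa_square[OF assms(2) order_refl]
      norm_triangle_ineq[of "of_real (norm a) - a" "of_real (norm b) - b"] by linarith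
qed

lemma sa_square_limit:
  fixes X :: "nat \<Rightarrow> 'a::{cstar_algebra, real_normed_algebra_1}"
  assumes X: "\<And>n. sa_square (X n)" and lim: "X \<longlonglongrightarrow> a"
  shows "sa_square a"
proof -
  have "Bseq X" using lim by (intro convergent_imp_Bseq) (auto simp: convergent_def)
  then obtain t where t: "\<And>n. norm (X n) \<le> t" by (auto simp: Bseq_def)
  show ?thesis
  proof (rule sa_square_if_norm_le)
    have "(\<lambda>n. star (X n)) \<longlonglongrightarrow> star a" by (intro tendsto_star lim)
    then show "star a = a" using lim LIMSEQ_unique by (simp add: sa_square_star[OF X]) blast
    have "(\<lambda>n. norm (of_real t - X n)) \<longlonglongrightarrow> norm (of_real t - a)"
      by (intro tendsto_intros lim)
    then show "norm (of_real t - a) \<le> t"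
      using norm_le_if_sa_square[OF X t] by (intro LIMSEQ_le_const2) auto
  qed
qed

lemma cfc_square:
  assumes b: "star b = b" and f: "continuous_on UNIV f"
  shows "cfc (b * b) f = cfc b (\<lambda>t. f (t * t))"
proof -
  have "cfc b (\<lambda>t. t * t) = b * b" by (simp add: cfc_mult b cfc_ident continuous_intros)
  moreover have "cfc (cfc b (\<lambda>t. t * t)) f = cfc b (\<lambda>t. f (t * t))"
    by (intro cfc_compose b f continuous_intros)
  ultimately show ?thesis by simp
qed

lemma cfc_pos_part_sa_square:
  assumes "sa_square a"
  shows "cfc a (max 0) = a" and "cfc (- a) (max 0) = 0"
proof -
  obtain b where b: "star b = b" "a = b * b" using assms by (auto simp: sa_square_def)
  have m: "continuous_on UNIV (max 0 :: real \<Rightarrow> real)" "continuous_on UNIV (\<lambda>t::real. max 0 (t * t))"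
    "continuous_on UNIV (\<lambda>t::real. - (t * t))" "continuous_on UNIV (\<lambda>t::real. max 0 (- (t * t)))"
    by (intro continuous_intros)+
  have "(\<lambda>t. max 0 (t * t)) = (\<lambda>t::real. t * t)" "(\<lambda>t. max 0 (- (t * t))) = (\<lambda>t::real. 0)"
    by (simp_all add: max_absorb1 max_absorb2)
  moreover have "cfc b (\<lambda>t. t * t) = a" by (simp add: b cfc_mult cfc_ident continuous_intros)
  moreover have "cfc b (\<lambda>t. - (t * t)) = - a"
    using cfc_minus[of b "\<lambda>t. t * t"] calculation(3) b by (simp add: continuous_intros)
  ultimately show "cfc a (max 0) = a" "cfc (- a) (max 0) = 0"
    using cfc_compose[OF b(1) m(3) m(1)] cfc_square[OF b(1) m(1)] b cfc_const[of b 0] by simp_all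
qed

text \<open>With \<open>s = \<parallel>a + b\<parallel>\<close>, both \<open>a = e\<^sup>2\<close> and \<open>s - a = d\<^sup>2\<close> for commuting self-adjoint \<open>d\<close>, \<open>e\<close>,
  and then \<open>e\<close> is the real part of \<open>w = e + i d\<close>, where \<open>w\<^sup>* w = s\<close>.\<close>

lemma norm_mono_sa_square:
  fixes a :: "'a::{cstar_algebra, real_normed_algebra_1}"
  assumes a: "sa_square a" and b: "sa_square b"
  shows "norm a \<le> norm (a + b)"
proof -
  define s where "s = norm (a + b)"
  have "of_real s - (of_real s - (a + b)) = a + b" by simp
  then have "norm (of_real s - (of_real s - (a + b))) \<le> s" by (simp only: s_def)
  then have "sa_square (of_real s - (a + b))"
    using sa_square_star[OF sa_square_add[OF a b]]
    by (intro sa_square_if_norm_le[where t = s]) (simp_all add: star_diff)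
  \<comment> \<open>Adding \<open>b\<close> back: \<open>s - a = (s - (a + b)) + b\<close>.\<close>
  from sa_square_add[OF this b] have sq: "sa_square (of_real s - a)" by (simp add: algebra_simps)
  obtain e where e: "star e = e" "a = e * e" using a by (auto simp: sa_square_def)
  let ?g = "\<lambda>t. sqrt (max 0 t)"
  have g: "continuous_on UNIV ?g" by (intro continuous_intros)
  define d where "d = cfc (of_real s - a) ?g"
  have sa: "star (of_real s - a) = of_real s - a" using sq by (rule sa_square_star)
  have sd: "star d = d" unfolding d_def by (intro star_cfc sa g)
  have "d * d = cfc (of_real s - a) (max 0)"
    unfolding d_def by (simp add: cfc_mult[OF sa g g, symmetric])
  then have dd: "d * d = of_real s - a" by (simp add: cfc_pos_part_sa_square[OF sq])
  have "(of_real s - a) * e = e * (of_real s - a)"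
    by (simp add: e algebra_simps of_real_commute mult.assoc)
  then have de: "d * e = e * d" unfolding d_def by (intro cfc_intertwine sa g)
  define w where "w = e + \<i> *\<^sub>C d"
  have star_w: "star w = e - \<i> *\<^sub>C d" by (simp add: w_def star_add star_scaleC e sd)
  have "star w * w = e * e + d * d"
    unfolding star_w unfolding w_def
    by (simp add: algebra_simps mult_scaleC_left mult_scaleC_right scaleC_scaleC de
        flip: scaleR_scaleC)
  then have "star w * w = of_real s" by (simp add: dd e(2)[symmetric])
  then have "(norm w)\<^sup>2 = s" using cstar_identity[of w] by (simp add: s_def)
  moreover have "norm e \<le> norm w"
  proof -
    have "w + star w = 2 *\<^sub>R e" unfolding star_w unfolding w_def by (simp add: scaleR_2)
    then have "norm (2 *\<^sub>R e) \<le> norm w + norm w"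
      using norm_triangle_ineq[of w "star w"] by simp
    then show ?thesis by simp
  qed
  ultimately have "(norm e)\<^sup>2 \<le> s" using power_mono[of "norm e" "norm w" 2] by simp
  then show ?thesis using e norm_sq_sa[of e] by (simp add: s_def)
qed

lemma cartesian_parts:
  fixes a :: "'a::cstar_algebra"
  obtains h k where "star h = h" "star k = k" "a = h + \<i> *\<^sub>C k" "norm h \<le> norm a" "norm k \<le> norm a"
proof
  let ?h = "(1/2) *\<^sub>R (a + star a)" and ?k = "(- \<i> / 2) *\<^sub>C (a - star a)"
  show "star ?h = ?h" by (simp add: star_scaleR star_add star_star add.commute)
  show "star ?k = ?k"
    by (simp add: star_scaleC star_diff star_star complex_vector.scale_right_diff_distrib)
  have "\<i> *\<^sub>C ?k = (1/2) *\<^sub>R (a - star a)"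
    by (simp add: scaleC_scaleC scaleR_scaleC)
  then show "a = ?h + \<i> *\<^sub>C ?k" by (simp add: scaleR_add_left[symmetric] algebra_simps)
  show "norm ?h \<le> norm a" using norm_triangle_ineq[of a "star a"] by simp
  show "norm ?k \<le> norm a" using norm_triangle_ineq4[of a "star a"]
    by (simp add: norm_scaleC norm_divide)
qed

text \<open>If \<open>y\<^sup>* y\<close> is negative, then \<open>y y\<^sup>* = 2 h\<^sup>2 + 2 k\<^sup>2 - y\<^sup>* y\<close> is positive, where \<open>y = h + i k\<close>. Since
  \<open>f (y y\<^sup>*) y = y f (y\<^sup>* y)\<close> for every \<open>f\<close>, in particular for the positive part, \<open>y y\<^sup>* y = 0\<close>.\<close>

lemma zero_if_star_mult_self_negative:
  fixes y :: "'a::{cstar_algebra, real_normed_algebra_1}"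
  assumes neg: "sa_square (- (star y * y))"
  shows "y = 0"
proof -
  obtain h k where hk: "star h = h" "star k = k" "y = h + \<i> *\<^sub>C k" by (rule cartesian_parts[of y])
  have star_y: "star y = h - \<i> *\<^sub>C k" by (simp add: hk star_add star_scaleC)
  have "y * star y + star y * y = (h * h + h * h) + (k * k + k * k)"
    unfolding star_y unfolding hk(3)
    by (simp add: algebra_simps mult_scaleC_left mult_scaleC_right scaleC_scaleC
        flip: scaleR_scaleC)
  then have "y * star y = (h * h + h * h) + (k * k + k * k) + - (star y * y)"
    by (simp add: eq_diff_eq)
  moreover have "sa_square (h * h)" "sa_square (k * k)" using hk by (auto simp: sa_square_def)
  ultimately have pos: "sa_square (y * star y)" by (metis sa_square_add neg)
  have "cfc (y * star y) (max 0) * y = y * cfc (star y * y) (max 0)"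
    by (intro cfc_intertwine continuous_intros) (simp_all add: star_mult star_star mult.assoc)
  then have "y * star y * y = 0"
    using cfc_pos_part_sa_square[OF pos] cfc_pos_part_sa_square[OF neg] by simp
  then have "(y * star y) * star (y * star y) = 0"
    by (simp add: star_mult star_star flip: mult.assoc)
  then show ?thesis by (simp only: mult_star_self_eq_zero)
qed

theorem sa_square_star_mult_self:
  fixes x :: "'a::{cstar_algebra, real_normed_algebra_1}"
  shows "sa_square (star x * x)"
proof -
  let ?a = "star x * x"
  have sa: "star ?a = ?a" by (simp add: star_mult star_star)
  let ?m = "\<lambda>t::real. max 0 (- t)"
  have m: "continuous_on UNIV ?m" by (intro continuous_intros)
  define n where "n = cfc ?a ?m"
  have sn: "star n = n" unfolding n_def by (intro star_cfc sa m)
  \<comment> \<open>The element \<open>y = x n\<close> satisfies \<open>y\<^sup>* y = n a n = - n\<^sup>3\<close>, hence vanishes.\<close>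
  have "n * ?a * n = cfc ?a (\<lambda>t. ?m t * t * ?m t)"
    by (simp add: cfc_mult sa n_def cfc_ident continuous_intros)
  also have "\<dots> = cfc ?a (\<lambda>t. - (?m t * ?m t * ?m t))"
    by (rule arg_cong[where f = "cfc ?a"]) (auto simp: max_def fun_eq_iff)
  also have "\<dots> = - cfc ?a (\<lambda>t. ?m t * ?m t * ?m t)"
    by (intro cfc_minus sa continuous_intros)
  finally have nan: "star (x * n) * (x * n) = - cfc ?a (\<lambda>t. ?m t * ?m t * ?m t)"
    by (simp add: star_mult sn mult.assoc)
  have "sa_square (cfc ?a (\<lambda>t. ?m t * ?m t * ?m t))"
    by (intro sa_square_cfc sa continuous_intros) auto
  then have "x * n = 0" using nan by (intro zero_if_star_mult_self_negative) simp
  then have "cfc ?a (\<lambda>t. ?m t * ?m t * ?m t) = 0" using nan by simp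
  then have "n * n * n = 0" by (simp add: cfc_mult sa n_def continuous_intros)
  then have "star (n * n) * (n * n) = 0" by (simp add: star_mult sn mult.assoc)
  then have "n * n = 0" by (simp only: star_mult_self_eq_zero)
  then have "star n * n = 0" by (simp only: sn)
  then have "n = 0" by (simp only: star_mult_self_eq_zero)
  moreover have "cfc ?a (\<lambda>t. max 0 t - ?m t) = cfc ?a (max 0) - n"
    unfolding n_def by (intro cfc_diff sa continuous_intros)
  moreover have "(\<lambda>t. max 0 t - ?m t) = (\<lambda>t. t)" by (auto simp: max_def)
  ultimately have "?a = cfc ?a (max 0)" by (simp add: cfc_ident sa)
  moreover have "sa_square (cfc ?a (max 0))"
    by (intro sa_square_cfc sa continuous_intros) auto
  ultimately show ?thesis by simp
qed

text \<open>The square root vanishes at \<open>0\<close>, so the root of an element of the algebra stays in the algebra.\<close>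

lemma positive_iff: "positive a \<longleftrightarrow> sa_square (incl a)"
proof
  assume "positive a"
  then obtain x where "a = star x * x" by (auto simp: positive_def)
  then show "sa_square (incl a)" using sa_square_star_mult_self[of "incl x"] by (simp add: incl_simps)
next
  assume sq: "sa_square (incl a)"
  then have sa: "star (incl a) = incl a" by (rule sa_square_star)
  let ?g = "\<lambda>t. sqrt (max 0 t)"
  have g: "continuous_on UNIV ?g" by (intro continuous_intros)
  define c where "c = cfc (incl a) ?g"
  have c: "cpart c = 0" unfolding c_def by (intro cpart_cfc sa g) auto
  have sc: "star c = c" unfolding c_def by (intro star_cfc sa g)
  have "c * c = cfc (incl a) (max 0)"
    unfolding c_def by (simp add: cfc_mult[OF sa g g, symmetric])
  then have "c * c = incl a" by (simp add: cfc_pos_part_sa_square[OF sq])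
  then have "incl (star (apart c) * apart c) = incl a"
    by (simp add: incl_simps incl_apart c sc)
  then have "a = star (apart c) * apart c" by simp
  then show "positive a" by (auto simp: positive_def)
qed

lemma positive_add: "positive a \<Longrightarrow> positive b \<Longrightarrow> positive (a + b)"
  by (simp add: positive_iff incl_simps sa_square_add)

lemma positive_zero: "positive 0"
  unfolding positive_def by (rule exI[of _ 0]) simp

lemma positive_scaleR: "positive a \<Longrightarrow> 0 \<le> r \<Longrightarrow> positive (r *\<^sub>R a)"
  unfolding positive_def
proof (elim exE)
  fix x assume "a = star x * x" "0 \<le> r"
  then show "\<exists>y. r *\<^sub>R a = star y * y"
    by (intro exI[of _ "sqrt r *\<^sub>R x"]) (simp add: star_scaleR)
qed

lemma positive_sum: "(\<And>i. i \<in> I \<Longrightarrow> positive (f i)) \<Longrightarrow> positive (sum f I)"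
  by (induction I rule: infinite_finite_induct) (auto intro: positive_add positive_zero)

lemma positive_suminf:
  fixes a :: "'a::cstar_algebra"
  assumes "\<And>n. positive (u n)" and "u sums a"
  shows "positive a"
proof -
  have "bounded_linear (incl :: 'a \<Rightarrow> 'a unitization)"
    by (rule bounded_linear_intro[where K = 1]) (simp_all add: incl_simps)
  from bounded_linear.tendsto[OF this] have "(\<lambda>n. incl (\<Sum>i<n. u i)) \<longlonglongrightarrow> incl a"
    using assms(2) by (simp add: sums_def)
  moreover have "sa_square (incl (\<Sum>i<n. u i))" for n
    using positive_sum[of "{..<n}" u] assms(1) by (simp add: positive_iff)
  ultimately show ?thesis unfolding positive_iff by (rule sa_square_limit[rotated])
qed

lemma norm_mono_positive: "positive a \<Longrightarrow> positive b \<Longrightarrow> norm a \<le> norm (a + b)"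
  using norm_mono_sa_square[of "incl a" "incl b"] by (simp add: positive_iff flip: incl_simps)

lemma positive_cfc:
  assumes sa: "star a = a" and f: "continuous_on UNIV f" "f 0 = 0" "\<And>t. \<bar>t\<bar> \<le> norm a \<Longrightarrow> 0 \<le> f t"
  shows "positive (apart (cfc (incl a) f))"
proof -
  have sa': "star (incl a) = incl a" using sa by (simp flip: incl_simps)
  show ?thesis
    unfolding positive_iff
    by (subst incl_apart) (auto intro!: cpart_cfc sa' f sa_square_cfc)
qed

lemma positive_decomposition:
  assumes sa: "star a = a"
  obtains p q where "positive p" "positive q" "a = p - q" "norm p \<le> norm a" "norm q \<le> norm a"
proof -
  have sa': "star (incl a) = incl a" using sa by (simp flip: incl_simps)
  let ?f = "\<lambda>t::real. max 0 t" and ?g = "\<lambda>t::real. max 0 (- t)"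
  let ?p = "apart (cfc (incl a) ?f)" and ?q = "apart (cfc (incl a) ?g)"
  have cont: "continuous_on UNIV ?f" "continuous_on UNIV ?g" by (intro continuous_intros)+
  have incl: "incl ?p = cfc (incl a) ?f" "incl ?q = cfc (incl a) ?g"
    by (intro incl_apart cpart_cfc sa' cont; simp)+
  show ?thesis
  proof
    show "positive ?p" "positive ?q" by (intro positive_cfc sa cont; simp)+
    have "incl ?p - incl ?q = cfc (incl a) (\<lambda>t. ?f t - ?g t)"
      unfolding incl using cfc_diff[OF sa' cont] by simp
    also have "(\<lambda>t. ?f t - ?g t) = (\<lambda>t. t)" by (auto simp: max_def)
    finally have "incl (?p - ?q) = incl a" by (simp only: cfc_ident[OF sa'] incl_simps)
    then show "a = ?p - ?q" by (simp only: incl_eq_iff)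
    have "norm (incl ?p) \<le> norm (incl a)" "norm (incl ?q) \<le> norm (incl a)"
      unfolding incl by (intro norm_cfc_le sa' cont; auto)+
    then show "norm ?p \<le> norm a" "norm ?q \<le> norm a" by simp_all
  qed
qed

text \<open>Positive elements span. Since positive elements are of the form \<open>star u * u\<close>, the algebra
  is also spanned by products, which substitutes for an approximate unit in what follows.\<close>

lemma positive_span_induct [case_names positive add scaleC]:
  assumes "\<And>p. positive p \<Longrightarrow> P p" and "\<And>x y. P x \<Longrightarrow> P y \<Longrightarrow> P (x + y)"
    and "\<And>c x. P x \<Longrightarrow> P (c *\<^sub>C x)"
  shows "P (a::'a::cstar_algebra)"
proof -
  have sa: "P h" if h: "star h = h" for h
  proof -
    obtain p q where "positive p" "positive q" "h = p - q"
      using positive_decomposition[OF h] by blast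
    moreover from this have "P (p + (- 1) *\<^sub>C q)" by (intro assms)
    ultimately show ?thesis by (simp add: scaleC_one)
  qed
  obtain h k where "star h = h" "star k = k" "a = h + \<i> *\<^sub>C k" using cartesian_parts by blast
  then show ?thesis using assms(2,3) sa by metis
qed

lemma sum_star_mult_self_zero:
  fixes z :: "nat \<Rightarrow> 'a::cstar_algebra"
  assumes "(\<Sum>k<n. star (z k) * z k) = 0" and k: "k < n"
  shows "z k = 0"
proof -
  have pos: "positive (star x * x)" for x :: 'a by (auto simp: positive_def)
  have "norm (star (z k) * z k) \<le> norm (star (z k) * z k + (\<Sum>i\<in>{..<n} - {k}. star (z i) * z i))"
    by (intro norm_mono_positive positive_sum pos)
  also have "\<dots> = 0" using assms sum.remove[of "{..<n}" k "\<lambda>i. star (z i) * z i"] by simp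
  finally show ?thesis by (simp add: star_mult_self_eq_zero)
qed

section \<open>Positive maps are bounded\<close>

text \<open>Otherwise choose positive \<open>a\<^sub>n\<close> in the unit ball with \<open>\<parallel>\<phi> a\<^sub>n\<parallel> > 4 ^ n\<close>. For
  \<open>s = \<Sum>\<^sub>n 2\<^sup>-\<^sup>n a\<^sub>n\<close> the difference \<open>s - 2\<^sup>-\<^sup>n a\<^sub>n\<close> is positive, so that
  \<open>\<parallel>\<phi> s\<parallel> \<ge> 2\<^sup>-\<^sup>n \<parallel>\<phi> a\<^sub>n\<parallel> > 2 ^ n\<close> for all \<open>n\<close>.\<close>

lemma positive_map_bounded_on_positive:
  fixes \<phi> :: "'a::cstar_algebra \<Rightarrow> 'b::cstar_algebra"
  assumes lin: "clinear \<phi>" and pos: "\<And>a. positive a \<Longrightarrow> positive (\<phi> a)"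
  shows "\<exists>C. \<forall>a. positive a \<and> norm a \<le> 1 \<longrightarrow> norm (\<phi> a) \<le> C"
proof (rule ccontr)
  assume "\<not> ?thesis"
  then have "\<exists>a. positive a \<and> norm a \<le> 1 \<and> norm (\<phi> a) > 4 ^ n" for n :: nat
    by (metis not_le)
  then obtain a where a: "\<And>n. positive (a n)" "\<And>n. norm (a n) \<le> 1" "\<And>n::nat. norm (\<phi> (a n)) > 4 ^ n"
    by metis
  define u where "u n = (1/2) ^ n *\<^sub>R a n" for n
  have u: "positive (u n)" for n unfolding u_def by (intro positive_scaleR a) simp
  have "norm (u n) \<le> (1/2) ^ n" for n
    using a(2)[of n] by (simp add: u_def power_abs mult_left_le)
  then have "summable u"
    by (intro summable_comparison_test'[OF summable_geometric[of "1/2"]]) auto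
  then obtain s where s: "u sums s" by (auto simp: summable_def)
  have "2 ^ n \<le> norm (\<phi> s)" for n :: nat
  proof -
    \<comment> \<open>The series of the remaining terms, all of which are positive.\<close>
    have "(\<lambda>k. u k - (if k = n then u k else 0)) sums (s - u n)"
      by (intro sums_diff s sums_single)
    then have "positive (s - u n)"
      by (rule positive_suminf[rotated]) (auto intro: u positive_zero)
    then have "norm (\<phi> (u n)) \<le> norm (\<phi> (u n) + \<phi> (s - u n))"
      by (intro norm_mono_positive pos u)
    also have "\<phi> (u n) + \<phi> (s - u n) = \<phi> s"
      using lin by (simp add: clinear_iff) (metis add.commute diff_add_cancel)
    finally have "norm (\<phi> (u n)) \<le> norm (\<phi> s)" .
    moreover have "norm (\<phi> (u n)) = (1/2) ^ n * norm (\<phi> (a n))"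
      using lin by (simp add: clinear_iff u_def scaleR_scaleC norm_scaleC norm_power norm_divide)
    moreover have "(1/2) ^ n * 4 ^ n \<le> (1/2) ^ n * norm (\<phi> (a n))"
      using a(3)[of n] by (intro mult_left_mono) auto
    moreover have "(1/2::real) ^ n * 4 ^ n = 2 ^ n" by (simp flip: power_mult_distrib)
    ultimately show ?thesis by simp
  qed
  then show False using real_arch_pow[of 2 "norm (\<phi> s)"] by (metis not_le one_less_numeral_iff semiring_norm(76))
qed

theorem positive_map_bounded_linear:
  fixes \<phi> :: "'a::cstar_algebra \<Rightarrow> 'b::cstar_algebra"
  assumes lin: "clinear \<phi>" and pos: "\<And>a. positive a \<Longrightarrow> positive (\<phi> a)"
  shows "bounded_linear \<phi>"
proof -
  have add: "\<phi> (x + y) = \<phi> x + \<phi> y" and scale: "\<phi> (c *\<^sub>C x) = c *\<^sub>C \<phi> x" for x y c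
    using lin by (auto simp: clinear_iff)
  have scaleR: "\<phi> (r *\<^sub>R x) = r *\<^sub>R \<phi> x" for r x by (simp add: scaleR_scaleC scale)
  interpret additive \<phi> by standard (rule add)
  obtain C where C: "\<And>a. positive a \<Longrightarrow> norm a \<le> 1 \<Longrightarrow> norm (\<phi> a) \<le> C"
    using positive_map_bounded_on_positive[OF assms] by blast
  have p: "norm (\<phi> a) \<le> C * norm a" if "positive a" for a
  proof (cases "a = 0")
    case False
    have "norm (\<phi> (inverse (norm a) *\<^sub>R a)) \<le> C"
      using False by (intro C positive_scaleR that) auto
    then show ?thesis using False by (simp add: scaleR field_simps)
  qed (simp add: zero)
  have sa: "norm (\<phi> h) \<le> 2 * C * norm h" if h: "star h = h" for h
  proof -
    obtain r s where rs: "positive r" "positive s" "h = r - s" "norm r \<le> norm h" "norm s \<le> norm h"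
      by (rule positive_decomposition[OF h])
    have "C \<ge> 0" using C[OF positive_zero] by (simp add: zero)
    then have "C * norm r \<le> C * norm h" "C * norm s \<le> C * norm h"
      using rs by (auto intro: mult_left_mono)
    then show ?thesis
      using norm_triangle_ineq4[of "\<phi> r" "\<phi> s"] p[OF rs(1)] p[OF rs(2)] by (simp add: rs(3) diff)
  qed
  show ?thesis
  proof (rule bounded_linear_intro[where K = "4 * C"])
    fix x :: 'a
    obtain h k where hk: "star h = h" "star k = k" "x = h + \<i> *\<^sub>C k" "norm h \<le> norm x" "norm k \<le> norm x"
      by (rule cartesian_parts[of x])
    have "C \<ge> 0" using C[OF positive_zero] by (simp add: zero)
    then have "C * norm h \<le> C * norm x" "C * norm k \<le> C * norm x"
      using hk by (auto intro: mult_left_mono)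
    moreover have "norm (\<phi> x) \<le> norm (\<phi> h) + norm (\<phi> k)"
      using norm_triangle_ineq[of "\<phi> h" "\<i> *\<^sub>C \<phi> k"] by (simp add: hk(3) add scale norm_scaleC)
    ultimately show "norm (\<phi> x) \<le> norm x * (4 * C)"
      using sa[OF hk(1)] sa[OF hk(2)] by (simp add: algebra_simps)
  qed (simp_all add: add scaleR)
qed

section \<open>Bilinear maps on continuous functions that vanish on functions with disjoint supports\<close>

definition ramp :: "real \<Rightarrow> real" where
  "ramp x = min 1 (max 0 x)"

lemma ramp_eq: "x \<le> 0 \<Longrightarrow> ramp x = 0" "1 \<le> x \<Longrightarrow> ramp x = 1"
  and ramp_bounds: "0 \<le> ramp x" "ramp x \<le> 1"
  by (auto simp: ramp_def)

lemma continuous_on_ramp [continuous_intros]: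
  "continuous_on S f \<Longrightarrow> continuous_on S (\<lambda>t. ramp (f t))"
  unfolding ramp_def by (intro continuous_intros)

text \<open>A continuous staircase: on \<open>[k, k + 1]\<close>, for \<open>k < N\<close>, it climbs by one on the ramp \<open>[k + c, k + c + 1/4]\<close> and is
  constant off the ramps.\<close>

definition stairs :: "nat \<Rightarrow> real \<Rightarrow> real \<Rightarrow> real" where
  "stairs N c x = (\<Sum>k<N. ramp (4 * (x - real k - c)))"

lemma continuous_on_stairs [continuous_intros]:
  "continuous_on S f \<Longrightarrow> continuous_on S (\<lambda>t. stairs N c (f t))"
  unfolding stairs_def by (intro continuous_intros)

lemma stairs_close:
  assumes c: "0 \<le> c" "c \<le> 3/4" and "0 \<le> x" "x \<le> real N"
  shows "\<bar>x - stairs N c x\<bar> \<le> 1"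
  using assms(3,4)
proof (induction N)
  case 0
  then show ?case by (simp add: stairs_def)
next
  case (Suc N)
  show ?case
  proof (cases "x \<le> real N")
    case True
    then have "stairs (Suc N) c x = stairs N c x"
      using c by (simp add: stairs_def ramp_eq)
    then show ?thesis using Suc.IH Suc.prems True by simp
  next
    case False
    have "stairs N c x = (\<Sum>k<N. 1)"
      unfolding stairs_def
    proof (rule sum.cong[OF refl])
      fix k assume "k \<in> {..<N}"
      then have "real k + 1 \<le> real N" by auto
      then show "ramp (4 * (x - real k - c)) = 1" using False c by (intro ramp_eq) simp
    qed
    then have "stairs (Suc N) c x = real N + ramp (4 * (x - real N - c))"
      by (simp add: stairs_def)
    then show ?thesis
      using ramp_bounds[of "4 * (x - real N - c)"] False Suc.prems by simp
  qed
qed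

text \<open>This vanishes on the ramps of \<open>stairs N 0\<close> and equals one on the ramps of
  \<open>stairs N (1/2)\<close>. Hence \<open>bump N\<close> and \<open>1 - bump N\<close> split the constant one into two functions, on the
  support of each of which one of the two staircases is locally constant.\<close>

definition bump :: "nat \<Rightarrow> real \<Rightarrow> real" where
  "bump N x = stairs N (1/4) x - stairs N (3/4) x"

lemma continuous_on_bump [continuous_intros]:
  "continuous_on S f \<Longrightarrow> continuous_on S (\<lambda>t. bump N (f t))"
  unfolding bump_def by (intro continuous_intros)

lemma bump_on_first_ramps:
  "ramp (4 * (x - real k)) * (1 - ramp (4 * (x - real k))) * bump N x = 0"
proof (cases "0 < 4 * (x - real k) \<and> 4 * (x - real k) < 1")
  case True
  have "ramp (4 * (x - real j - 1/4)) = ramp (4 * (x - real j - 3/4))" for j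
  proof (cases "j < k")
    case True
    then have "real j + 1 \<le> real k" by simp
    then show ?thesis using \<open>0 < 4 * (x - real k) \<and> _\<close> by (simp add: ramp_eq)
  next
    case False
    then have "real k \<le> real j" by simp
    then show ?thesis using \<open>0 < 4 * (x - real k) \<and> _\<close> by (simp add: ramp_eq)
  qed
  then show ?thesis by (simp add: bump_def stairs_def)
next
  case False
  then show ?thesis using ramp_eq[of "4 * (x - real k)"] by fastforce
qed

lemma bump_on_second_ramps:
  assumes "k < N"
  shows "ramp (4 * (x - real k - 1/2)) * (1 - ramp (4 * (x - real k - 1/2))) * (1 - bump N x) = 0"
proof (cases "0 < 4 * (x - real k - 1/2) \<and> 4 * (x - real k - 1/2) < 1")
  case True
  have "ramp (4 * (x - real j - 1/4)) - ramp (4 * (x - real j - 3/4)) = (if j = k then 1 else 0)" for j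
  proof -
    consider "real j + 1 \<le> real k" | "j = k" | "real k + 1 \<le> real j" by linarith
    then show ?thesis by cases (use True in \<open>auto simp: ramp_eq\<close>)
  qed
  then have "bump N x = (\<Sum>j<N. if j = k then 1 else 0)"
    by (simp add: bump_def stairs_def flip: sum_subtractf)
  then show ?thesis using assms by simp
next
  case False
  then show ?thesis using ramp_eq[of "4 * (x - real k - 1/2)"] by fastforce
qed

text \<open>Such a \<open>T\<close> should be thought of as a distribution on the square supported on the diagonal;
  boundedness in the supremum norm excludes derivatives, whence the coordinate functions may be
  exchanged (\<open>diagonal\<close>).\<close>

locale local_bilinear =
  fixes T :: "(real \<Rightarrow> real) \<Rightarrow> (real \<Rightarrow> real) \<Rightarrow> 'b::real_normed_vector" and R K :: real
  assumes add_left: "\<And>f f' g. continuous_on UNIV f \<Longrightarrow> continuous_on UNIV f' \<Longrightarrow> continuous_on UNIV g \<Longrightarrow>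
      T (\<lambda>t. f t + f' t) g = T f g + T f' g"
    and add_right: "\<And>f g g'. continuous_on UNIV f \<Longrightarrow> continuous_on UNIV g \<Longrightarrow> continuous_on UNIV g' \<Longrightarrow>
      T f (\<lambda>t. g t + g' t) = T f g + T f g'"
    and scale_left: "\<And>c f g. continuous_on UNIV f \<Longrightarrow> continuous_on UNIV g \<Longrightarrow>
      T (\<lambda>t. c * f t) g = c *\<^sub>R T f g"
    and scale_right: "\<And>c f g. continuous_on UNIV f \<Longrightarrow> continuous_on UNIV g \<Longrightarrow>
      T f (\<lambda>t. c * g t) = c *\<^sub>R T f g"
    and bounded: "\<And>f g F G. continuous_on UNIV f \<Longrightarrow> continuous_on UNIV g \<Longrightarrow>
      (\<And>t. \<bar>t\<bar> \<le> R \<Longrightarrow> \<bar>f t\<bar> \<le> F) \<Longrightarrow> (\<And>t. \<bar>t\<bar> \<le> R \<Longrightarrow> \<bar>g t\<bar> \<le> G) \<Longrightarrow> norm (T f g) \<le> K * F * G"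
    and disjoint: "\<And>f g. continuous_on UNIV f \<Longrightarrow> continuous_on UNIV g \<Longrightarrow> (\<And>t. f t * g t = 0) \<Longrightarrow> T f g = 0"
    and K: "0 \<le> K" and R: "0 \<le> R"
begin

text \<open>Where \<open>f g\<close> does not vanish, \<open>r\<close> takes only the values \<open>0\<close> and \<open>1\<close>, so \<open>r f\<close> and \<open>(1 - r) g\<close> have
  disjoint supports, and both sides equal \<open>T (r f) (r g)\<close>.\<close>

lemma move_step:
  assumes c: "continuous_on UNIV f" "continuous_on UNIV g" "continuous_on UNIV r"
    and z: "\<And>t. r t * (1 - r t) * f t * g t = 0"
  shows "T (\<lambda>t. r t * f t) g = T f (\<lambda>t. r t * g t)"
proof -
  note cont = c continuous_intros
  have "T (\<lambda>t. r t * f t) (\<lambda>t. r t * g t + (1 - r t) * g t)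
      = T (\<lambda>t. r t * f t) (\<lambda>t. r t * g t) + T (\<lambda>t. r t * f t) (\<lambda>t. (1 - r t) * g t)"
    by (intro add_right cont)
  moreover have "T (\<lambda>t. r t * f t) (\<lambda>t. (1 - r t) * g t) = 0"
    using z by (intro disjoint cont) (simp add: mult_ac)
  moreover have "T (\<lambda>t. r t * f t + (1 - r t) * f t) (\<lambda>t. r t * g t)
      = T (\<lambda>t. r t * f t) (\<lambda>t. r t * g t) + T (\<lambda>t. (1 - r t) * f t) (\<lambda>t. r t * g t)"
    by (intro add_left cont)
  moreover have "T (\<lambda>t. (1 - r t) * f t) (\<lambda>t. r t * g t) = 0"
    using z by (intro disjoint cont) (simp add: mult_ac)
  moreover have "(\<lambda>t. r t * g t + (1 - r t) * g t) = g" "(\<lambda>t. r t * f t + (1 - r t) * f t) = f"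
    by (auto simp: algebra_simps)
  ultimately show ?thesis by simp
qed

text \<open>A staircase that is locally constant on the support of \<open>f\<close> is an affine combination of ramps that
  take only the values \<open>0\<close> and \<open>1\<close> there.\<close>

lemma move_stairs:
  fixes X :: "real \<Rightarrow> real"
  assumes f: "continuous_on UNIV f" and X: "continuous_on UNIV X"
    and z: "\<And>k t. k < N \<Longrightarrow> ramp (4 * (X t - real k - c)) * (1 - ramp (4 * (X t - real k - c))) * f t = 0"
  shows "T (\<lambda>t. (h * stairs N c (X t) - s) * f t) (\<lambda>t. 1) = T f (\<lambda>t. h * stairs N c (X t) - s)"
proof -
  note cont = f X continuous_intros
  have "T (\<lambda>t. stairs M c (X t) * f t) (\<lambda>t. 1) = T f (\<lambda>t. stairs M c (X t))" if "M \<le> N" for M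
    using that
  proof (induction M)
    case 0
    then show ?case
      using disjoint[of "\<lambda>t. 0" "\<lambda>t. 1"] disjoint[of f "\<lambda>t. 0"] by (simp add: stairs_def f)
  next
    case (Suc M)
    let ?r = "\<lambda>t. ramp (4 * (X t - real M - c))"
    have "T (\<lambda>t. stairs M c (X t) * f t + ?r t * f t) (\<lambda>t. 1)
        = T (\<lambda>t. stairs M c (X t) * f t) (\<lambda>t. 1) + T (\<lambda>t. ?r t * f t) (\<lambda>t. 1)"
      by (intro add_left cont)
    also have "T (\<lambda>t. ?r t * f t) (\<lambda>t. 1) = T f (\<lambda>t. ?r t * 1)"
      using z[of M] Suc.prems by (intro move_step cont) simp
    also have "T (\<lambda>t. stairs M c (X t) * f t) (\<lambda>t. 1) + T f (\<lambda>t. ?r t * 1)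
        = T f (\<lambda>t. stairs M c (X t)) + T f (\<lambda>t. ?r t)"
      using Suc by simp
    also have "\<dots> = T f (\<lambda>t. stairs M c (X t) + ?r t)"
      by (intro add_right[symmetric] cont)
    finally show ?case by (simp add: stairs_def distrib_right)
  qed
  then have eq: "T (\<lambda>t. stairs N c (X t) * f t) (\<lambda>t. 1) = T f (\<lambda>t. stairs N c (X t))" by simp
  have "T (\<lambda>t. h * (stairs N c (X t) * f t) + (- s) * f t) (\<lambda>t. 1)
      = T (\<lambda>t. h * (stairs N c (X t) * f t)) (\<lambda>t. 1) + T (\<lambda>t. (- s) * f t) (\<lambda>t. 1)"
    by (intro add_left cont)
  also have "\<dots> = h *\<^sub>R T (\<lambda>t. stairs N c (X t) * f t) (\<lambda>t. 1) + (- s) *\<^sub>R T f (\<lambda>t. 1)"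
    by (intro arg_cong2[where f = "(+)"] scale_left cont)
  also have "\<dots> = h *\<^sub>R T f (\<lambda>t. stairs N c (X t)) + (- s) *\<^sub>R T f (\<lambda>t. 1)"
    by (simp only: eq)
  also have "\<dots> = T f (\<lambda>t. h * stairs N c (X t)) + T f (\<lambda>t. (- s) * 1)"
    by (intro arg_cong2[where f = "(+)"] scale_right[symmetric] cont)
  also have "\<dots> = T f (\<lambda>t. h * stairs N c (X t) + (- s) * 1)"
    by (intro add_right[symmetric] cont)
  finally show ?thesis by (simp add: algebra_simps)
qed

text \<open>The bound \<open>3\<close> is satisfied by the bump functions and by their differences from one.\<close>

lemma almost_move:
  assumes f: "continuous_on UNIV f" and s: "continuous_on UNIV s"
    and fb: "\<And>t. \<bar>t\<bar> \<le> R \<Longrightarrow> \<bar>f t\<bar> \<le> 3" and sb: "\<And>t. \<bar>t\<bar> \<le> R \<Longrightarrow> \<bar>t - s t\<bar> \<le> h"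
    and move: "T (\<lambda>t. s t * f t) (\<lambda>t. 1) = T f s"
  shows "norm (T (\<lambda>t. t * f t) (\<lambda>t. 1) - T f (\<lambda>t. t)) \<le> 6 * K * h"
proof -
  note cont = f s continuous_intros
  have "T (\<lambda>t. (t - s t) * f t + s t * f t) (\<lambda>t. 1)
      = T (\<lambda>t. (t - s t) * f t) (\<lambda>t. 1) + T (\<lambda>t. s t * f t) (\<lambda>t. 1)"
    by (intro add_left cont)
  moreover have "T f (\<lambda>t. (t - s t) + s t) = T f (\<lambda>t. t - s t) + T f s"
    by (intro add_right cont)
  moreover have "(\<lambda>t. (t - s t) * f t + s t * f t) = (\<lambda>t. t * f t)" "(\<lambda>t. (t - s t) + s t) = (\<lambda>t. t)"
    by (simp_all add: left_diff_distrib)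
  ultimately have "T (\<lambda>t. t * f t) (\<lambda>t. 1) - T f (\<lambda>t. t)
      = T (\<lambda>t. (t - s t) * f t) (\<lambda>t. 1) - T f (\<lambda>t. t - s t)"
    using move by simp
  moreover have "norm (T (\<lambda>t. (t - s t) * f t) (\<lambda>t. 1)) \<le> K * (h * 3) * 1"
    by (intro bounded cont) (auto simp: abs_mult intro!: mult_mono fb sb order_trans[OF abs_ge_zero sb])
  moreover have "norm (T f (\<lambda>t. t - s t)) \<le> K * 3 * h"
    by (intro bounded cont fb sb)
  ultimately show ?thesis
    using norm_triangle_ineq4[of "T (\<lambda>t. (t - s t) * f t) (\<lambda>t. 1)" "T f (\<lambda>t. t - s t)"] by simp
qed

text \<open>Split one of the arguments \<open>1\<close> as \<open>f + (1 - f)\<close> with \<open>f\<close> a bump function of mesh \<open>h\<close>. On each part the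
  coordinate function is within \<open>h\<close> of a staircase that can be moved across exactly, so the total
  error is a multiple of \<open>h\<close>. The number of steps does not enter.\<close>

theorem diagonal: "T (\<lambda>t. t) (\<lambda>t. 1) = T (\<lambda>t. 1) (\<lambda>t. t)"
proof -
  let ?D = "T (\<lambda>t. t) (\<lambda>t. 1) - T (\<lambda>t. 1) (\<lambda>t. t)"
  have small: "norm ?D \<le> 12 * K * h" if h: "h > 0" for h
  proof -
    \<comment> \<open>The interval \<open>[- R, R]\<close> is mapped into \<open>[0, N]\<close> by a chart in which \<open>h\<close> has length one.\<close>
    define N where "N = nat \<lceil>2 * R / h\<rceil>"
    define X where "X t = (t + R) / h" for t
    have X: "continuous_on UNIV X" unfolding X_def using h by (intro continuous_intros) auto
    define f where "f t = bump N (X t)" for t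
    define s where "s c t = h * stairs N c (X t) - R" for c t
    have f: "continuous_on UNIV f" unfolding f_def by (intro continuous_intros X)
    have s: "continuous_on UNIV (s c)" for c unfolding s_def by (intro continuous_intros X)
    have Xb: "0 \<le> X t" "X t \<le> real N" if "\<bar>t\<bar> \<le> R" for t
    proof -
      show "0 \<le> X t" using that h by (simp add: X_def)
      have "X t \<le> 2 * R / h" unfolding X_def using that h by (intro divide_right_mono) auto
      then show "X t \<le> real N" unfolding N_def using real_nat_ceiling_ge order_trans by blast
    qed
    have sb: "\<bar>t - s c t\<bar> \<le> h" if "0 \<le> c" "c \<le> 3/4" "\<bar>t\<bar> \<le> R" for c t
    proof -
      have "t - s c t = h * (X t - stairs N c (X t))" using h by (simp add: s_def X_def field_simps)
      then have "\<bar>t - s c t\<bar> = h * \<bar>X t - stairs N c (X t)\<bar>" using h by (simp add: abs_mult)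
      also have "\<dots> \<le> h * 1" using h that Xb by (intro mult_left_mono stairs_close) auto
      finally show ?thesis by simp
    qed
    have fb: "\<bar>f t\<bar> \<le> 2" if "\<bar>t\<bar> \<le> R" for t
      using stairs_close[of "1/4" "X t" N] stairs_close[of "3/4" "X t" N] Xb[OF that]
      unfolding f_def bump_def by linarith
    have "norm (T (\<lambda>t. t * f t) (\<lambda>t. 1) - T f (\<lambda>t. t)) \<le> 6 * K * h"
    proof (rule almost_move[OF f s])
      show "T (\<lambda>t. s 0 t * f t) (\<lambda>t. 1) = T f (s 0)"
        unfolding s_def using bump_on_first_ramps by (intro move_stairs f X) (simp add: f_def)
    qed (use fb sb[of 0] in fastforce)+
    moreover have f': "continuous_on UNIV (\<lambda>t. 1 - f t)" by (intro continuous_intros f)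
    have "norm (T (\<lambda>t. t * (1 - f t)) (\<lambda>t. 1) - T (\<lambda>t. 1 - f t) (\<lambda>t. t)) \<le> 6 * K * h"
    proof (rule almost_move[OF f' s])
      show "T (\<lambda>t. s (1/2) t * (1 - f t)) (\<lambda>t. 1) = T (\<lambda>t. 1 - f t) (s (1/2))"
        unfolding s_def using bump_on_second_ramps by (intro move_stairs f' X) (simp add: f_def)
      show "\<bar>1 - f t\<bar> \<le> 3" if "\<bar>t\<bar> \<le> R" for t using fb[OF that] by linarith
    qed (use sb[of "1/2"] in auto)
    moreover have "T (\<lambda>t. t * f t + t * (1 - f t)) (\<lambda>t. 1)
        = T (\<lambda>t. t * f t) (\<lambda>t. 1) + T (\<lambda>t. t * (1 - f t)) (\<lambda>t. 1)"
      by (intro add_left f f' continuous_intros)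
    then have "T (\<lambda>t. t) (\<lambda>t. 1) = T (\<lambda>t. t * f t) (\<lambda>t. 1) + T (\<lambda>t. t * (1 - f t)) (\<lambda>t. 1)"
      by (simp add: algebra_simps)
    moreover have "T (\<lambda>t. f t + (1 - f t)) (\<lambda>t. t) = T f (\<lambda>t. t) + T (\<lambda>t. 1 - f t) (\<lambda>t. t)"
      by (intro add_left f f' continuous_intros)
    then have "T (\<lambda>t. 1) (\<lambda>t. t) = T f (\<lambda>t. t) + T (\<lambda>t. 1 - f t) (\<lambda>t. t)" by simp
    ultimately show ?thesis
      using norm_triangle_ineq[of "T (\<lambda>t. t * f t) (\<lambda>t. 1) - T f (\<lambda>t. t)"
          "T (\<lambda>t. t * (1 - f t)) (\<lambda>t. 1) - T (\<lambda>t. 1 - f t) (\<lambda>t. t)"]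
      by (simp add: algebra_simps)
  qed
  have "norm ?D \<le> e" if e: "e > 0" for e
  proof -
    have "norm ?D \<le> 12 * K * (e / (12 * K + 1))" using e K by (intro small) simp
    also have "\<dots> \<le> e" using e K by (simp add: field_simps)
    finally show ?thesis .
  qed
  then have "norm ?D \<le> 0" by (rule field_le_epsilon[where y = 0, simplified])
  then show ?thesis by simp
qed

end

section \<open>Orthogonality preserving completely positive maps\<close>

text \<open>Complete positivity for the Gram matrix of \<open>x\<close> and \<open>v\<close>: the values of \<open>\<phi>\<close> form a Gram matrix again.\<close>

lemma completely_positive_gram:
  assumes "completely_positive \<phi>"
  obtains Y Z where "\<phi> (star x * x) = (\<Sum>k<2. star (Y k) * Y k)"
    and "\<phi> (star v * x) = (\<Sum>k<2. star (Z k) * Y k)"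
    and "\<phi> (star x * v) = (\<Sum>k<(2::nat). star (Y k) * Z k)"
proof -
  define z where "z i = (if i = 0 then x else v)" for i :: nat
  have "positive_matrix 2 (\<lambda>i j. star (z i) * z j)"
    unfolding positive_matrix_def
    by (rule exI[of _ "\<lambda>k i. if k = 0 then z i else 0"]) (simp add: numeral_2_eq_2)
  then have "positive_matrix 2 (\<lambda>i j. \<phi> (star (z i) * z j))"
    using assms by (simp add: completely_positive_def)
  then obtain W where W: "\<forall>i<2. \<forall>j<2. \<phi> (star (z i) * z j) = (\<Sum>k<(2::nat). star (W k i) * W k j)"
    unfolding positive_matrix_def ..
  have z: "z 0 = x" "z 1 = v" by (simp_all add: z_def)
  show ?thesis
  proof (rule that[of "\<lambda>k. W k 0" "\<lambda>k. W k 1"])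
    show "\<phi> (star x * x) = (\<Sum>k<2. star (W k 0) * W k 0)"
      using W[rule_format, of 0 0] unfolding z by simp
    show "\<phi> (star v * x) = (\<Sum>k<2. star (W k 1) * W k 0)"
      using W[rule_format, of 1 0] unfolding z by simp
    show "\<phi> (star x * v) = (\<Sum>k<2. star (W k 0) * W k 1)"
      using W[rule_format, of 0 1] unfolding z by simp
  qed
qed

text \<open>In a Gram matrix with columns \<open>Y\<close> and \<open>Z\<close>, the equation \<open>Y\<^sup>* Y c = 0\<close> forces \<open>Y c = 0\<close>, since a sum of
  positive elements is zero only if every summand is. Hence \<open>Z\<^sup>* Y c = 0\<close>.\<close>

lemma completely_positive_zero_right:
  assumes cp: "completely_positive \<phi>" and zero: "\<phi> (star x * x) * c = 0"
  shows "\<phi> (star v * x) * c = 0"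
proof -
  obtain Y Z where YZ: "\<phi> (star x * x) = (\<Sum>k<2. star (Y k) * Y k)"
    "\<phi> (star v * x) = (\<Sum>k<(2::nat). star (Z k) * Y k)"
    by (rule completely_positive_gram[OF cp, of x v])
  have "(\<Sum>k<2. star (Y k * c) * (Y k * c)) = star c * (\<phi> (star x * x) * c)"
    by (simp add: YZ sum_distrib_left sum_distrib_right star_mult mult.assoc)
  then have "Y k * c = 0" if "k < 2" for k
    using that zero by (intro sum_star_mult_self_zero[of "\<lambda>k. Y k * c" 2]) auto
  then show ?thesis by (simp add: YZ sum_distrib_right mult.assoc)
qed

lemma completely_positive_zero_left:
  assumes cp: "completely_positive \<phi>" and zero: "c * \<phi> (star x * x) = 0"
  shows "c * \<phi> (star x * v) = 0"
proof -
  obtain Y Z where YZ: "\<phi> (star x * x) = (\<Sum>k<2. star (Y k) * Y k)"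
    "\<phi> (star x * v) = (\<Sum>k<(2::nat). star (Y k) * Z k)"
    by (rule completely_positive_gram[OF cp, of x v])
  have "(\<Sum>k<2. star (Y k * star c) * (Y k * star c)) = (c * \<phi> (star x * x)) * star c"
    by (simp add: YZ sum_distrib_left sum_distrib_right star_mult star_star mult.assoc)
  then have Y: "Y k * star c = 0" if "k < 2" for k
    using that zero by (intro sum_star_mult_self_zero[of "\<lambda>k. Y k * star c" 2]) auto
  have "c * star (Y k) = 0" if "k < 2" for k
    using arg_cong[OF Y[OF that], of star] by (simp add: star_mult star_star)
  then show ?thesis by (simp add: YZ sum_distrib_left flip: mult.assoc)
qed

text \<open>If \<open>x y = 0\<close> then \<open>x\<^sup>* x\<close> and \<open>y y\<^sup>*\<close> are orthogonal positive elements. Complete positivity then replaces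
  the left factor \<open>x\<^sup>*\<close> and the right factor \<open>y\<^sup>*\<close> by arbitrary ones.\<close>

lemma orthogonality_preserving_products:
  assumes cp: "completely_positive \<phi>" and op: "orthogonality_preserving \<phi>" and xy: "x * y = 0"
  shows "\<phi> (v * x) * \<phi> (y * w) = 0"
proof -
  have "positive (star x * x)" "positive (star (star y) * star y)" by (auto simp: positive_def)
  moreover have "(star x * x) * (star (star y) * star y) = star x * (x * y) * star y"
    by (simp add: star_star mult.assoc)
  moreover have "star x * (x * y) * star y = 0" by (simp add: xy)
  ultimately have "\<phi> (star x * x) * \<phi> (star (star y) * star y) = 0"
    using op unfolding orthogonality_preserving_def by metis
  then have "\<phi> (star (star v) * x) * \<phi> (star (star y) * star y) = 0"
    by (rule completely_positive_zero_right[OF cp])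
  then have "\<phi> (star (star v) * x) * \<phi> (star (star y) * w) = 0"
    by (rule completely_positive_zero_left[OF cp])
  then show ?thesis by (simp add: star_star)
qed

lemma completely_positive_positive:
  assumes "completely_positive \<phi>" "positive a"
  shows "positive (\<phi> a)"
proof -
  obtain x where "a = star x * x" using assms(2) by (auto simp: positive_def)
  then have "positive_matrix 1 (\<lambda>i j. a)"
    unfolding positive_matrix_def by (intro exI[of _ "\<lambda>k i. x"]) simp
  then have "positive_matrix 1 (\<lambda>i j. \<phi> a)"
    using assms(1) by (simp add: completely_positive_def)
  then obtain W where "\<phi> a = star (W 0 0) * W 0 0"
    unfolding positive_matrix_def by auto
  then show ?thesis by (auto simp: positive_def)
qed

text \<open>The map \<open>(f, g) \<mapsto> \<phi> (v x f(a)) \<phi> (g(a) y w)\<close> is bounded and vanishes when \<open>f g = 0\<close>; its values at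
  \<open>(id, 1)\<close> and \<open>(1, id)\<close> are the two sides.\<close>

lemma shift_self_adjoint:
  assumes cp: "completely_positive \<phi>" and op: "orthogonality_preserving \<phi>" and sa: "star a = a"
  shows "\<phi> (v * (x * a)) * \<phi> (y * w) = \<phi> (v * x) * \<phi> ((a * y) * w)"
proof -
  have lin: "clinear \<phi>" using cp by (simp add: completely_positive_def)
  have add: "\<phi> (x + y) = \<phi> x + \<phi> y" for x y using lin by (auto simp: clinear_iff)
  have scale: "\<phi> (r *\<^sub>R x) = r *\<^sub>R \<phi> x" for r x
    using lin by (simp add: clinear_iff scaleR_scaleC)
  have "bounded_linear \<phi>"
    by (rule positive_map_bounded_linear[OF lin completely_positive_positive[OF cp]])
  then obtain B where B: "B > 0" "\<And>x. norm (\<phi> x) \<le> norm x * B"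
    using bounded_linear.pos_bounded by blast
  have sa': "star (incl a) = incl a" using sa by (simp flip: incl_simps)
  define r where "r f = apart (incl x * cfc (incl a) f)" for f
  define l where "l f = apart (cfc (incl a) f * incl y)" for f
  have incl_r: "incl (r f) = incl x * cfc (incl a) f" and incl_l: "incl (l f) = cfc (incl a) f * incl y" for f
    unfolding r_def l_def by (intro incl_apart; simp)+
  have norm_r: "norm (r f) \<le> norm x * F" and norm_l: "norm (l f) \<le> F * norm y"
    if "continuous_on UNIV f" "\<And>t. \<bar>t\<bar> \<le> norm a \<Longrightarrow> \<bar>f t\<bar> \<le> F" for f F
  proof -
    have c: "norm (cfc (incl a) f) \<le> F" using that by (intro norm_cfc_le sa') auto
    have "norm (incl (r f)) \<le> norm (incl x) * norm (cfc (incl a) f)"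
      unfolding incl_r by (rule norm_mult_ineq)
    also have "\<dots> \<le> norm (incl x) * F" by (intro mult_left_mono c) simp
    finally show "norm (r f) \<le> norm x * F" by simp
    have "norm (incl (l f)) \<le> norm (cfc (incl a) f) * norm (incl y)"
      unfolding incl_l by (rule norm_mult_ineq)
    also have "\<dots> \<le> F * norm (incl y)" by (intro mult_right_mono c) simp
    finally show "norm (l f) \<le> F * norm y" by simp
  qed
  define T where "T f g = \<phi> (v * r f) * \<phi> (l g * w)" for f g
  interpret local_bilinear T "norm a" "norm v * norm x * B * (norm y * norm w * B)"
  proof
    fix f f' g :: "real \<Rightarrow> real"
    assume c: "continuous_on UNIV f" "continuous_on UNIV f'" "continuous_on UNIV g"
    show "T (\<lambda>t. f t + f' t) g = T f g + T f' g"
      by (simp add: T_def r_def cfc_add sa' c distrib_left distrib_right add)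
  next
    fix f g g' :: "real \<Rightarrow> real"
    assume c: "continuous_on UNIV f" "continuous_on UNIV g" "continuous_on UNIV g'"
    show "T f (\<lambda>t. g t + g' t) = T f g + T f g'"
      by (simp add: T_def l_def cfc_add sa' c distrib_left distrib_right add)
  next
    fix c and f g :: "real \<Rightarrow> real"
    assume cont: "continuous_on UNIV f" "continuous_on UNIV g"
    show "T (\<lambda>t. c * f t) g = c *\<^sub>R T f g" "T f (\<lambda>t. c * g t) = c *\<^sub>R T f g"
      by (simp_all add: T_def r_def l_def cfc_scale sa' cont scale del: apart_simps(8) add: apart_simps(7))
  next
    fix f g :: "real \<Rightarrow> real" and F G :: real
    assume f: "continuous_on UNIV f" "\<And>t. \<bar>t\<bar> \<le> norm a \<Longrightarrow> \<bar>f t\<bar> \<le> F"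
      and g: "continuous_on UNIV g" "\<And>t. \<bar>t\<bar> \<le> norm a \<Longrightarrow> \<bar>g t\<bar> \<le> G"
    have F: "0 \<le> F" using f(2)[of 0] by simp
    have "norm (v * r f) \<le> norm v * (norm x * F)"
      by (rule order_trans[OF norm_mult_ineq]) (intro mult_left_mono norm_r f; simp)
    then have 1: "norm (\<phi> (v * r f)) \<le> norm v * (norm x * F) * B"
      using B by (meson mult_right_mono order_trans less_imp_le)
    have "norm (l g * w) \<le> (G * norm y) * norm w"
      by (rule order_trans[OF norm_mult_ineq]) (intro mult_right_mono norm_l g; simp)
    then have 2: "norm (\<phi> (l g * w)) \<le> (G * norm y) * norm w * B"
      using B by (meson mult_right_mono order_trans less_imp_le)
    have "norm (T f g) \<le> (norm v * (norm x * F) * B) * ((G * norm y) * norm w * B)"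
      unfolding T_def using 1 2 F B(1) by (intro order_trans[OF norm_mult_ineq] mult_mono) auto
    then show "norm (T f g) \<le> norm v * norm x * B * (norm y * norm w * B) * F * G"
      by (simp add: mult_ac)
  next
    fix f g :: "real \<Rightarrow> real"
    assume c: "continuous_on UNIV f" "continuous_on UNIV g" and z: "\<And>t. f t * g t = 0"
    have "incl (r f * l g) = incl x * (cfc (incl a) f * cfc (incl a) g) * incl y"
      by (simp add: incl_simps incl_r incl_l mult.assoc)
    also have "cfc (incl a) f * cfc (incl a) g = 0"
      using cfc_const[OF sa', of 0] by (simp add: cfc_mult[OF sa' c, symmetric] z)
    finally have "incl (r f * l g) = incl 0" by (simp add: incl_simps)
    then have "r f * l g = 0" by (simp only: incl_eq_iff)
    then show "T f g = 0" unfolding T_def by (rule orthogonality_preserving_products[OF cp op])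
  qed (use B in auto)
  have one: "r (\<lambda>t. 1) = x" "l (\<lambda>t. 1) = y"
    by (simp_all add: r_def l_def cfc_const sa' scaleC_one)
  have id: "r (\<lambda>t. t) = x * a" "l (\<lambda>t. t) = a * y"
    by (simp_all add: r_def l_def cfc_ident sa')
  show ?thesis using diagonal by (simp add: T_def one id)
qed

text \<open>The product \<open>\<phi> x * \<phi> y\<close> depends only on \<open>x * y\<close>. This carries the multiplicative content of the structure
  theorem \<open>\<phi> a = h \<pi>(a)\<close> for order zero maps, where both sides are \<open>h\<^sup>2 \<pi>(x a y)\<close>.\<close>

theorem order_zero_shift:
  assumes cp: "completely_positive \<phi>" and op: "orthogonality_preserving \<phi>"
  shows "\<phi> (x * a) * \<phi> y = \<phi> x * \<phi> (a * y)"
proof -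
  have add: "\<phi> (x + y) = \<phi> x + \<phi> y" and scale: "\<phi> (c *\<^sub>C x) = c *\<^sub>C \<phi> x" for c x y
    using cp by (auto simp: completely_positive_def clinear_iff)
  note lin = add scale distrib_left distrib_right mult_scaleC_left mult_scaleC_right
  \<comment> \<open>First extend from self-adjoint \<open>a\<close> to all \<open>a\<close>, then from products to arbitrary outer factors.\<close>
  have 1: "\<phi> (v * (x * a)) * \<phi> (y * w) = \<phi> (v * x) * \<phi> ((a * y) * w)" for v x y w
  proof (induction a rule: positive_span_induct)
    case (positive p)
    then have "star p = p" by (auto simp: positive_def star_mult star_star)
    then show ?case by (rule shift_self_adjoint[OF cp op])
  qed (simp_all add: lin)
  have 2: "\<phi> (v * (x * a)) * \<phi> y = \<phi> (v * x) * \<phi> (a * y)" for v x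
  proof (induction y rule: positive_span_induct)
    case (positive p)
    then obtain u where "p = star u * u" by (auto simp: positive_def)
    then show ?case using 1[of v x "star u" u] by (simp add: mult.assoc)
  qed (simp_all add: lin)
  show ?thesis
  proof (induction x rule: positive_span_induct)
    case (positive p)
    then obtain u where "p = star u * u" by (auto simp: positive_def)
    then show ?case using 2[of "star u" u] by (simp add: mult.assoc)
  qed (simp_all add: lin)
qed

text \<open>In the picture \<open>\<phi> a = h \<pi>(a)\<close> the element \<open>d\<close> is \<open>\<pi> y\<close>. The point is that it lies in the target algebra:
  if \<open>\<phi> y = \<phi> p * \<phi> q\<close>, which is \<open>h\<^sup>2 \<pi>(p q)\<close>, then \<open>\<pi> y\<close> must be \<open>h \<pi>(p q) = \<phi> (p * q)\<close>. That this
  choice works is checked after multiplying by two further values of \<open>\<phi>\<close>, using only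
  \<open>order_zero_shift\<close>; by surjectivity these values range over everything. The factors \<open>p\<close>, \<open>q\<close> exist for
  positive \<open>y\<close> because \<open>\<phi> y\<close> is then of the form \<open>star u * u\<close>.\<close>

theorem surjective_order_zero_modular:
  assumes cp: "completely_positive \<phi>" and op: "orthogonality_preserving \<phi>" and surj: "surj \<phi>"
  shows "\<exists>d. \<forall>f. \<phi> (f * y) = \<phi> f * d \<and> \<phi> (y * f) = d * \<phi> f"
proof -
  have lin: "\<phi> (a + b) = \<phi> a + \<phi> b" "\<phi> (c *\<^sub>C a) = c *\<^sub>C \<phi> a" for a b c
    using cp by (auto simp: completely_positive_def clinear_iff)
  show ?thesis
  proof (induction y rule: positive_span_induct)
    case (positive y)
    have shift: "\<phi> (x * a) * \<phi> z = \<phi> x * \<phi> (a * z)" for x a z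
      by (rule order_zero_shift[OF cp op])
    have cancel: "b = c" if "\<And>s t. b * \<phi> s * \<phi> t = c * \<phi> s * \<phi> t" for b c
    proof -
      have "(b - c) * s * t = 0" for s t
      proof -
        obtain s' where s: "s = \<phi> s'" by (rule surjE[OF surj])
        obtain t' where t: "t = \<phi> t'" by (rule surjE[OF surj])
        show ?thesis unfolding s t left_diff_distrib using that[of s' t'] by simp
      qed
      then have "(b - c) * s = 0" for s by (rule annihilator_zero)
      then have "b - c = 0" by (rule annihilator_zero)
      then show "b = c" by (simp only: right_minus_eq)
    qed
    have cancel': "b = c" if "\<And>s t. \<phi> s * (\<phi> t * b) = \<phi> s * (\<phi> t * c)" for b c
    proof -
      have "s * (t * (b - c)) = 0" for t s
      proof -
        obtain s' where s: "s = \<phi> s'" by (rule surjE[OF surj])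
        obtain t' where t: "t = \<phi> t'" by (rule surjE[OF surj])
        show ?thesis unfolding s t right_diff_distrib using that[of s' t'] by simp
      qed
      then have "t * (b - c) = 0" for t by (rule annihilator_zero')
      then have "b - c = 0" by (rule annihilator_zero')
      then show "b = c" by (simp only: right_minus_eq)
    qed
    have "positive (\<phi> y)" by (rule completely_positive_positive[OF cp positive])
    then obtain u where u: "\<phi> y = star u * u" unfolding positive_def ..
    obtain p where p: "star u = \<phi> p" by (rule surjE[OF surj])
    obtain q where q: "u = \<phi> q" by (rule surjE[OF surj])
    have pq: "\<phi> y = \<phi> p * \<phi> q" unfolding u p[symmetric] by (simp only: q[symmetric])
    have "\<phi> (f * y) = \<phi> f * \<phi> (p * q)" for f
    proof (rule cancel)
      fix s t
      have "\<phi> f * \<phi> (p * q) * \<phi> s * \<phi> t = \<phi> f * \<phi> p * (\<phi> (q * s) * \<phi> t)"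
        by (simp only: shift[of p q s] mult.assoc)
      also have "\<dots> = \<phi> f * \<phi> y * \<phi> (s * t)"
        by (simp only: shift[of q s t] pq mult.assoc)
      also have "\<dots> = \<phi> f * \<phi> (y * s) * \<phi> t"
        by (simp only: shift[of y s t] mult.assoc)
      also have "\<dots> = \<phi> (f * y) * \<phi> s * \<phi> t"
        by (simp only: shift[of f y s])
      finally show "\<phi> (f * y) * \<phi> s * \<phi> t = \<phi> f * \<phi> (p * q) * \<phi> s * \<phi> t" ..
    qed
    moreover have "\<phi> (y * f) = \<phi> (p * q) * \<phi> f" for f
    proof (rule cancel')
      fix s t
      have "\<phi> s * (\<phi> t * (\<phi> (p * q) * \<phi> f)) = \<phi> s * (\<phi> t * \<phi> (p * q)) * \<phi> f"
        by (simp only: mult.assoc)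
      also have "\<dots> = \<phi> s * \<phi> (t * p) * \<phi> q * \<phi> f"
        by (simp only: shift[of t p q, symmetric] mult.assoc)
      also have "\<dots> = \<phi> (s * t) * \<phi> y * \<phi> f"
        by (simp only: shift[of s t p, symmetric] pq mult.assoc)
      also have "\<dots> = \<phi> s * (\<phi> (t * y) * \<phi> f)"
        by (simp only: shift[of s t y] mult.assoc)
      also have "\<dots> = \<phi> s * (\<phi> t * \<phi> (y * f))"
        by (simp only: shift[of t y f])
      finally show "\<phi> s * (\<phi> t * \<phi> (y * f)) = \<phi> s * (\<phi> t * (\<phi> (p * q) * \<phi> f))" ..
    qed
    ultimately show ?case by blast
  next
    case (add x y)
    then obtain d e where "\<forall>f. \<phi> (f * x) = \<phi> f * d \<and> \<phi> (x * f) = d * \<phi> f"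
      "\<forall>f. \<phi> (f * y) = \<phi> f * e \<and> \<phi> (y * f) = e * \<phi> f" by blast
    then show ?case
      by (intro exI[of _ "d + e"]) (simp add: lin distrib_left distrib_right)
  next
    case (scaleC c x)
    then obtain d where "\<forall>f. \<phi> (f * x) = \<phi> f * d \<and> \<phi> (x * f) = d * \<phi> f" by blast
    then show ?case
      by (intro exI[of _ "c *\<^sub>C d"]) (simp add: lin mult_scaleC_left mult_scaleC_right)
  qed
qed

section \<open>The Pedersen ideal\<close>

lemma geometric_inverse:
  fixes y :: "'a::{real_normed_algebra_1, banach}"
  assumes "norm y < 1"
  obtains z where "(1 + y) * z = 1"
proof
  let ?x = "- y"
  have "summable (\<lambda>n. ?x ^ n)" using assms by (intro complete_algebra_summable_geometric) simp
  then have "(\<Sum>n. ?x ^ Suc n) = (\<Sum>n. ?x ^ n) - ?x ^ 0"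
    "(\<Sum>n. ?x ^ Suc n) = ?x * (\<Sum>n. ?x ^ n)"
    using suminf_split_head[of "\<lambda>n. ?x ^ n"] by (simp_all only: power_Suc suminf_mult)
  then have "(\<Sum>n. ?x ^ n) - 1 = ?x * (\<Sum>n. ?x ^ n)" by (metis power_0)
  then show "(1 + y) * (\<Sum>n. ?x ^ n) = 1" by (simp add: algebra_simps)
qed

text \<open>Take \<open>x\<close> in \<open>J\<close> with \<open>\<parallel>x - e\<parallel> < 1\<close> and \<open>y = x - e\<close>. Then \<open>f x = f (1 + y)\<close> lies in \<open>J\<close>, and \<open>1 + y\<close> is invertible
  in the unitization, in which \<open>J\<close> is still a right ideal.\<close>

lemma mem_dense_ideal_if_right_unit:
  assumes J: "dense_two_sided_ideal J" and fe: "f * e = f"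
  shows "f \<in> J"
proof -
  have ideal: "two_sided_ideal J" and dense: "closure J = UNIV"
    using J by (auto simp: dense_two_sided_ideal_def)
  obtain x where x: "x \<in> J" "dist x e < 1"
  proof -
    have "e \<in> closure J" by (simp add: dense)
    then show ?thesis using that zero_less_one unfolding closure_approachable by blast
  qed
  define y where "y = x - e"
  have "norm (incl y) < 1" using x(2) by (simp add: y_def dist_norm)
  then obtain z where z: "(1 + incl y) * z = 1" by (rule geometric_inverse)
  define g where "g = f * x"
  have "g \<in> J" using ideal x(1) by (auto simp: g_def two_sided_ideal_def)
  have "incl g = incl f * (1 + incl y)"
  proof -
    have "g = f + f * y" by (simp add: g_def y_def right_diff_distrib fe)
    then show ?thesis by (simp add: incl_simps distrib_left)
  qed
  then have "incl g * z = incl f" using z by (simp add: mult.assoc)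
  then have "apart (incl g * z) = f" by simp
  then have "f = g * apart z + cpart z *\<^sub>C g" by simp
  then show ?thesis
    using ideal \<open>g \<in> J\<close> by (simp add: two_sided_ideal_def complex_vector.subspace_def)
qed

text \<open>A positive \<open>p\<close> is the limit of \<open>(p - \<delta>)\<^sub>+\<close>, which has the function \<open>min 1 (t / \<delta>)\<close> of \<open>p\<close> as a unit,
  because \<open>t / \<delta> \<ge> 1\<close> wherever \<open>t - \<delta> > 0\<close>.\<close>

lemma closure_ideal_UNIV:
  fixes I :: "'a::cstar_algebra set"
  assumes I: "two_sided_ideal I" and units: "\<And>f e. f * e = f \<Longrightarrow> f \<in> I"
  shows "closure I = UNIV"
proof -
  have add_I: "x + y \<in> I" and scale_I: "c *\<^sub>C x \<in> I" if "x \<in> I" "y \<in> I" for x y c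
    using I that by (auto simp: two_sided_ideal_def complex_vector.subspace_def)
  have "a \<in> closure I" for a
  proof (induction a rule: positive_span_induct)
    case (positive p)
    then have sq: "sa_square (incl p)" by (simp add: positive_iff)
    then have sa: "star (incl p) = incl p" by (rule sa_square_star)
    show ?case unfolding closure_approachable
    proof (intro allI impI)
      fix \<epsilon> :: real assume \<epsilon>: "\<epsilon> > 0"
      define \<delta> where "\<delta> = \<epsilon> / 2"
      have \<delta>: "\<delta> > 0" using \<epsilon> by (simp add: \<delta>_def)
      let ?f = "\<lambda>t. max 0 (t - \<delta>)" and ?e = "\<lambda>t. min 1 (max 0 (t / \<delta>))"
      have cont: "continuous_on UNIV ?f" "continuous_on UNIV ?e" "continuous_on UNIV (max 0 :: real \<Rightarrow> real)"
        using \<delta> by (auto intro!: continuous_intros)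
      let ?x = "apart (cfc (incl p) ?f)" and ?y = "apart (cfc (incl p) ?e)"
      have incl: "incl ?x = cfc (incl p) ?f" "incl ?y = cfc (incl p) ?e"
        using \<delta> by (intro incl_apart cpart_cfc sa cont; simp)+
      have "incl (?x * ?y) = cfc (incl p) (\<lambda>t. ?f t * ?e t)"
        by (simp add: incl_simps incl cfc_mult[OF sa cont(1,2)] del: apart_simps)
      also have "(\<lambda>t. ?f t * ?e t) = ?f"
        using \<delta> by (auto simp: fun_eq_iff max_def min_def field_simps)
      finally have "incl (?x * ?y) = incl ?x" by (simp only: incl)
      then have "?x * ?y = ?x" by (simp only: incl_eq_iff)
      then have "?x \<in> I" by (rule units)
      moreover have "norm (cfc (incl p) (\<lambda>t. ?f t - max 0 t)) \<le> \<delta>"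
        using \<delta> by (intro norm_cfc_le sa continuous_intros cont) (auto simp: max_def)
      then have "norm (incl ?x - incl p) \<le> \<delta>"
        by (simp add: incl cfc_diff[OF sa cont(1,3)] cfc_pos_part_sa_square[OF sq])
      then have "dist ?x p < \<epsilon>"
        using \<epsilon> by (simp add: dist_norm \<delta>_def flip: incl_simps)
      ultimately show "\<exists>y\<in>I. dist y p < \<epsilon>" by blast
    qed
  next
    case (add x y)
    then obtain X Y where "\<And>n. X n \<in> I" "X \<longlonglongrightarrow> x" "\<And>n. Y n \<in> I" "Y \<longlonglongrightarrow> y"
      by (auto simp: closure_sequential)
    then have "\<forall>n. X n + Y n \<in> I" "(\<lambda>n. X n + Y n) \<longlonglongrightarrow> x + y"
      by (auto intro: add_I tendsto_add)
    then show ?case unfolding closure_sequential by (intro exI[of _ "\<lambda>n. X n + Y n"]) simp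
  next
    case (scaleC c x)
    then obtain X where X: "\<And>n. X n \<in> I" "X \<longlonglongrightarrow> x" by (auto simp: closure_sequential)
    have "(\<lambda>n. c *\<^sub>C X n) \<longlonglongrightarrow> c *\<^sub>C x"
      by (rule bounded_linear.tendsto[OF bounded_linear_const_scaleC[OF bounded_linear_ident] X(2)])
    then show ?case
      unfolding closure_sequential using scale_I[OF X(1) X(1)] by (intro exI[of _ "\<lambda>n. c *\<^sub>C X n"]) simp
  qed
  then show ?thesis by blast
qed

text \<open>Elements that possess a right unit lie in every dense two-sided ideal, and they generate a
  dense one. So the intersection of all dense two-sided ideals is dense itself.\<close>

theorem dense_pedersen_ideal:
  "dense_two_sided_ideal (pedersen_ideal :: 'a::cstar_algebra set)"
  and pedersen_ideal_least: "dense_two_sided_ideal (J :: 'a set) \<Longrightarrow> pedersen_ideal \<subseteq> J"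
proof -
  let ?P = "\<Inter>{J :: 'a set. dense_two_sided_ideal J}"
  have ideal: "two_sided_ideal ?P"
    unfolding dense_two_sided_ideal_def two_sided_ideal_def complex_vector.subspace_def by blast
  moreover have "closure ?P = UNIV"
    by (rule closure_ideal_UNIV[OF ideal]) (auto intro: mem_dense_ideal_if_right_unit)
  ultimately have dense: "dense_two_sided_ideal ?P" by (simp add: dense_two_sided_ideal_def)
  then have "pedersen_ideal = ?P"
    unfolding pedersen_ideal_def by (intro Least_equality) auto
  then show "dense_two_sided_ideal (pedersen_ideal :: 'a set)"
    "dense_two_sided_ideal J \<Longrightarrow> pedersen_ideal \<subseteq> J" using dense by auto
qed

theorem theorem4p6:
  fixes \<phi> :: "'a::cstar_algebra \<Rightarrow> 'b::cstar_algebra"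
  assumes "completely_positive \<phi>"
    and "orthogonality_preserving \<phi>"
    and "faithful \<phi>"
    and "surj \<phi>"
    and "simple_cstar TYPE('b) \<or> prime_cstar TYPE('b) \<or>
      finite_dimensional (centre :: 'b multiplier set)"
  shows "\<phi> ` pedersen_ideal \<subseteq> pedersen_ideal"
proof -
  have lin: "clinear \<phi>" using assms(1) by (simp add: completely_positive_def)
  note factor = surjective_order_zero_modular[OF assms(1,2,4)]
  let ?P = "pedersen_ideal :: 'b set"
  have P: "dense_two_sided_ideal ?P" by (rule dense_pedersen_ideal)
  then have ideal: "two_sided_ideal ?P" by (simp add: dense_two_sided_ideal_def)
  have "two_sided_ideal (\<phi> -` ?P)"
    unfolding two_sided_ideal_def
  proof (intro conjI ballI allI)
    have "\<phi> 0 = 0" using lin by (metis clinear_iff complex_vector.scale_zero_left)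
    then show "complex_vector.subspace (\<phi> -` ?P)"
      using lin ideal by (simp add: clinear_iff two_sided_ideal_def complex_vector.subspace_def)
  next
    fix x a assume x: "x \<in> \<phi> -` ?P"
    obtain d where "\<phi> (x * a) = \<phi> x * d" "\<phi> (a * x) = d * \<phi> x" using factor[of a] by blast
    then show "a * x \<in> \<phi> -` ?P" "x * a \<in> \<phi> -` ?P"
      using x ideal by (auto simp: two_sided_ideal_def)
  qed
  moreover from this have "closure (\<phi> -` ?P) = UNIV"
  proof (rule closure_ideal_UNIV)
    \<comment> \<open>A right unit of \<open>f\<close> is carried to a right unit of \<open>\<phi> f\<close>.\<close>
    fix f e :: 'a assume "f * e = f"
    moreover obtain d where "\<phi> (f * e) = \<phi> f * d" using factor[of e] by blast
    ultimately have "\<phi> f * d = \<phi> f" by simp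
    then show "f \<in> \<phi> -` ?P" using mem_dense_ideal_if_right_unit[OF P] by simp
  qed
  ultimately have "dense_two_sided_ideal (\<phi> -` ?P)" by (simp add: dense_two_sided_ideal_def)
  then have "pedersen_ideal \<subseteq> \<phi> -` ?P" by (rule pedersen_ideal_least)
  then show ?thesis by blast
qed

end
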